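(* Let $b_1$ and $b_2$ be one-variable finite Blaschke products with simple zeros $z_1,\dots,z_n$ and $w_1,\dots,w_n$ in $\mathbb D$, respectively. Let $G_1,G_2\in H^\infty(\mathbb T)$ and put $\phi(x,y)=\overline{b_1(x)}\,\overline{b_2(y)}\,G_1(x)G_2(y)$. Let $\Gamma^\phi:K_{b_1b_2}\to K_{b_1b_2}$ be the multiplier defined on $e\in K_{b_1b_2}$, written as $$e=\sum_{i,j=1}^nc_{ij}\xi_i(x)\eta_j(y)+\sum_{i=1}^n\xi_i(x)b_2(y)h_i''(y)+\sum_{j=1}^n\eta_j(y)b_1(x)h_j'(x),$$ by $$\Gamma^\phi e=\sum_{i,j}c_{ij}\big(G_1(x)G_2(w_j)+G_1(z_i)G_2(y)-G_1(z_i)G_2(w_j)\big)\xi_i(x)\eta_j(y)+\sum_iG_1(z_i)G_2(y)\xi_i(x)b_2(y)h_i''(y)+\sum_jG_1(x)G_2(w_j)\eta_j(y)b_1(x)h_j'(x).$$ Then $\|\Gamma^\phi\|=\|\Gamma_\phi\|$, where $\Gamma_\phi:H^2(\mathbb T^2)\to H^2(\mathbb T^2)^\perp$ is the big Hankel operator with symbol $\phi$.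
   Context: $\mathbb T$ is the unit circle with normalized Lebesgue measure; $x,y\in\mathbb T$ are identified with points $e^{ix},e^{iy}$ of the unit circle. $P$ is the orthogonal projection of $L^2(\mathbb T^2)$ onto $H^2(\mathbb T^2)$, and $\Gamma_\phi f=(I-P)(\phi f)$. $K_{b_1b_2}=H^2(\mathbb T^2)\ominus b_1(x)b_2(y)H^2(\mathbb T^2)$. Define $$\xi_i(x)=\frac{b_1(e^{ix})}{e^{ix}-z_i},\qquad \eta_j(y)=\frac{b_2(e^{iy})}{e^{iy}-w_j}.$$ These are eigenfunctions of the one-variable model operators: $\{\xi_i\}$ is a basis of $H^2(\mathbb T)\ominus b_1H^2(\mathbb T)$ and $\{\eta_j\}$ is a basis of $H^2(\mathbb T)\ominus b_2H^2(\mathbb T)$. Every $e\in K_{b_1b_2}$ has a unique representation of the displayed form, with $c_{ij}\in\mathbb C$ and $h_j',h_i''\in H^2(\mathbb T)$ one-variable functions. This comes from the orthogonal decomposition $$K_{b_1b_2}=(K_{b_1}\otimes K_{b_2})\oplus(K_{b_1}\otimes b_2H^2)\oplus(b_1H^2\otimes K_{b_2}),\qquad K_{b_k}=H^2(\mathbb T)\ominus b_kH^2(\mathbb T).$$ $\Gamma^\phi$ is defined by the displayed formula and extended linearly; norms are $L^2(\mathbb T^2)$ operator norms. *)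

theory Defs
  imports "HOL-Analysis.Analysis"
begin

text \<open>Points of the circle are parametrised by angles x in [0, 2 pi]; the point is cis x = e^{ix}.
  Functions on T are real => complex, functions on T^2 are real * real => complex.
  All measures are normalised Lebesgue measure.\<close>

definition circ :: "real set" where "circ = {0..2*pi}"
definition torus :: "(real \<times> real) set" where "torus = circ \<times> circ"

definition L2_1 :: "(real \<Rightarrow> complex) \<Rightarrow> bool" where
  "L2_1 f \<longleftrightarrow> f \<in> borel_measurable lborel \<and>
     (\<integral>\<^sup>+ x\<in>circ. ennreal ((cmod (f x))\<^sup>2) \<partial>lborel) < \<infinity>"

definition L2_2 :: "(real \<times> real \<Rightarrow> complex) \<Rightarrow> bool" where
  "L2_2 f \<longleftrightarrow> f \<in> borel_measurable lborel \<and>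
     (\<integral>\<^sup>+ p\<in>torus. ennreal ((cmod (f p))\<^sup>2) \<partial>lborel) < \<infinity>"

definition norm2 :: "(real \<times> real \<Rightarrow> complex) \<Rightarrow> real" where
  "norm2 f = sqrt (enn2real (\<integral>\<^sup>+ p\<in>torus. ennreal ((cmod (f p))\<^sup>2) \<partial>lborel) / (4 * pi\<^sup>2))"

definition inner2 :: "(real \<times> real \<Rightarrow> complex) \<Rightarrow> (real \<times> real \<Rightarrow> complex) \<Rightarrow> complex" where
  "inner2 f g = (LINT p:torus|lborel. f p * cnj (g p)) / of_real (4 * pi\<^sup>2)"

definition fourier1 :: "(real \<Rightarrow> complex) \<Rightarrow> int \<Rightarrow> complex" where
  "fourier1 f m = (LINT x:circ|lborel. f x * cis (- (of_int m * x))) / of_real (2 * pi)"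

definition fourier2 :: "(real \<times> real \<Rightarrow> complex) \<Rightarrow> int \<Rightarrow> int \<Rightarrow> complex" where
  "fourier2 f m n = (LINT p:torus|lborel. f p * cis (- (of_int m * fst p + of_int n * snd p)))
                      / of_real (4 * pi\<^sup>2)"

definition H2_1 :: "(real \<Rightarrow> complex) set" where
  "H2_1 = {f. L2_1 f \<and> (\<forall>m<0. fourier1 f m = 0)}"

definition H2_2 :: "(real \<times> real \<Rightarrow> complex) set" where
  "H2_2 = {f. L2_2 f \<and> (\<forall>m n. (m < 0 \<or> n < 0) \<longrightarrow> fourier2 f m n = 0)}"

text \<open>H^infinity(T): G is the boundary function (a.e. radial limit) of the bounded
  holomorphic function g on the unit disc; g(z) is the value of G at z in D.\<close>
definition Hinf :: "(complex \<Rightarrow> complex) \<Rightarrow> (real \<Rightarrow> complex) \<Rightarrow> bool" where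
  "Hinf g G \<longleftrightarrow> g holomorphic_on ball 0 1 \<and> bounded (g ` ball 0 1) \<and>
     G \<in> borel_measurable lborel \<and>
     (AE x in lborel. x \<in> circ \<longrightarrow> ((\<lambda>r. g (of_real r * cis x)) \<longlongrightarrow> G x) (at_left 1))"

definition blaschke :: "complex \<Rightarrow> (nat \<Rightarrow> complex) \<Rightarrow> nat \<Rightarrow> complex \<Rightarrow> complex" where
  "blaschke c zs n z = c * (\<Prod>k<n. (z - zs k) / (1 - cnj (zs k) * z))"

definition simple_blaschke :: "(complex \<Rightarrow> complex) \<Rightarrow> (nat \<Rightarrow> complex) \<Rightarrow> nat \<Rightarrow> bool" where
  "simple_blaschke b zs n \<longleftrightarrow>
     (\<exists>c. cmod c = 1 \<and> b = blaschke c zs n) \<and> (\<forall>k<n. cmod (zs k) < 1) \<and> inj_on zs {..<n}"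

text \<open>Gamma_phi f = (I - P)(phi f); the value (I-P)(phi f) is phi f - h where h is the
  (a.e. unique) element of H^2(T^2) with phi f - h orthogonal to H^2(T^2).\<close>
definition hankel_norm :: "(real \<times> real \<Rightarrow> complex) \<Rightarrow> real" where
  "hankel_norm \<phi> = Sup {norm2 (\<lambda>p. \<phi> p * f p - h p) | f h.
       f \<in> H2_2 \<and> norm2 f \<le> 1 \<and> h \<in> H2_2 \<and>
       (\<forall>k\<in>H2_2. inner2 (\<lambda>p. \<phi> p * f p - h p) k = 0)}"

definition xi :: "(complex \<Rightarrow> complex) \<Rightarrow> complex \<Rightarrow> real \<Rightarrow> complex" where
  "xi b z x = b (cis x) / (cis x - z)"

definition Kelem ::
  "(complex \<Rightarrow> complex) \<Rightarrow> (complex \<Rightarrow> complex) \<Rightarrow> (nat \<Rightarrow> complex) \<Rightarrow> (nat \<Rightarrow> complex) \<Rightarrow> nat \<Rightarrow>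
   (nat \<Rightarrow> nat \<Rightarrow> complex) \<Rightarrow> (nat \<Rightarrow> real \<Rightarrow> complex) \<Rightarrow> (nat \<Rightarrow> real \<Rightarrow> complex) \<Rightarrow>
   real \<times> real \<Rightarrow> complex" where
  "Kelem b1 b2 zs ws n c h1 h2 p =
     (let x = fst p; y = snd p in
       (\<Sum>i<n. \<Sum>j<n. c i j * xi b1 (zs i) x * xi b2 (ws j) y)
     + (\<Sum>i<n. xi b1 (zs i) x * b2 (cis y) * h2 i y)
     + (\<Sum>j<n. xi b2 (ws j) y * b1 (cis x) * h1 j x))"

text \<open>Gamma^phi applied to that element (g1, g2 are the holomorphic extensions of G1, G2).\<close>
definition Gamma_up ::
  "(complex \<Rightarrow> complex) \<Rightarrow> (complex \<Rightarrow> complex) \<Rightarrow> (nat \<Rightarrow> complex) \<Rightarrow> (nat \<Rightarrow> complex) \<Rightarrow> nat \<Rightarrow>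
   (complex \<Rightarrow> complex) \<Rightarrow> (real \<Rightarrow> complex) \<Rightarrow> (complex \<Rightarrow> complex) \<Rightarrow> (real \<Rightarrow> complex) \<Rightarrow>
   (nat \<Rightarrow> nat \<Rightarrow> complex) \<Rightarrow> (nat \<Rightarrow> real \<Rightarrow> complex) \<Rightarrow> (nat \<Rightarrow> real \<Rightarrow> complex) \<Rightarrow>
   real \<times> real \<Rightarrow> complex" where
  "Gamma_up b1 b2 zs ws n g1 G1 g2 G2 c h1 h2 p =
     (let x = fst p; y = snd p in
       (\<Sum>i<n. \<Sum>j<n. c i j * (G1 x * g2 (ws j) + g1 (zs i) * G2 y - g1 (zs i) * g2 (ws j))
                          * xi b1 (zs i) x * xi b2 (ws j) y)
     + (\<Sum>i<n. g1 (zs i) * G2 y * xi b1 (zs i) x * b2 (cis y) * h2 i y)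
     + (\<Sum>j<n. G1 x * g2 (ws j) * xi b2 (ws j) y * b1 (cis x) * h1 j x))"

text \<open>Operator norm of Gamma^phi on K_{b1b2}: every e in K_{b1b2} is Kelem ... c h1 h2 for
  unique c, h1 j, h2 i in H^2(T), so this is the supremum of norm2 (Gamma^phi e) over the unit ball.\<close>
definition Gamma_up_norm ::
  "(complex \<Rightarrow> complex) \<Rightarrow> (complex \<Rightarrow> complex) \<Rightarrow> (nat \<Rightarrow> complex) \<Rightarrow> (nat \<Rightarrow> complex) \<Rightarrow> nat \<Rightarrow>
   (complex \<Rightarrow> complex) \<Rightarrow> (real \<Rightarrow> complex) \<Rightarrow> (complex \<Rightarrow> complex) \<Rightarrow> (real \<Rightarrow> complex) \<Rightarrow> real" where
  "Gamma_up_norm b1 b2 zs ws n g1 G1 g2 G2 =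
     Sup {norm2 (Gamma_up b1 b2 zs ws n g1 G1 g2 G2 c h1 h2) | c h1 h2.
            (\<forall>j<n. h1 j \<in> H2_1) \<and> (\<forall>i<n. h2 i \<in> H2_1) \<and>
            norm2 (Kelem b1 b2 zs ws n c h1 h2) \<le> 1}"

end

theory Submission
  imports Defs "HOL-Complex_Analysis.Cauchy_Integral_Formula" "HOL-Probability.Probability_Measure"
begin

text \<open>Write B = b1 b2 and G = G1 G2. Since B is unimodular on the torus, B (I - P)(cnj B G f) is the
  orthogonal projection of G f onto the model space K, so the Hankel operator has the same norm as the
  compression of multiplication by G to K (it vanishes on B H^2). That compression is exactly Gamma:
  G e - Gamma e is divisible by B in H^2, because (G1 - g1(z_i)) xi_i = b1 (G1 - g1(z_i)) / (x - z_i) and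
  difference quotients of bounded analytic functions are again bounded analytic; and Gamma e is
  orthogonal to B H^2, because each of its terms carries a factor xi_i(x) or eta_j(y). Hence the two
  suprema are taken over the same set of numbers.

  The decomposition f = e + B k comes from partial fractions: on the circle
  cnj b = 1 / b = C + sum_i r_i / (w - z_i), so that with a_i = r_i f(z_i, .) the function
  cnj b (f - sum_i xi_i a_i) = C f + sum_i r_i (f - f(z_i, .)) / (w - z_i) lies in H^2.\<close>

subsection \<open>The normalised measures on the circle and the torus\<close>

text \<open>Membership in the Hardy spaces means vanishing of Fourier coefficients, whereas
  \<open>Hinf\<close> speaks of radial limits, so analytic facts must be converted into facts about
  coefficients. For products the bridge is \<open>H2_2_mult_fst\<close>: power series on circles of
  radius below 1, then dominated convergence towards the boundary. A function given on the torus has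
  no value f(z, .) at a point of the disc; a Cauchy integral over the boundary takes its place. The
  second obstacle is mixed: if all coefficients with one fixed first index m vanish, then f must be
  orthogonal to e^{imx} q(y) for every square-integrable q, not only for trigonometric polynomials.
  This reduces to an integrable function on the circle all of whose coefficients are zero, hence the
  section on uniqueness. The projection P is never constructed: an explicit decomposition together
  with an orthogonality proof determines its value a.e.\<close>

definition circle_measure :: "real measure" ("\<mu>") where
  "\<mu> = density lborel (\<lambda>x. ennreal (indicator circ x / (2 * pi)))"

abbreviation torus_measure :: "(real \<times> real) measure" ("\<mu>\<^sub>2") where
  "\<mu>\<^sub>2 \<equiv> \<mu> \<Otimes>\<^sub>M \<mu>"

lemma circ_sets [measurable]: "circ \<in> sets borel"
  by (simp add: circ_def)

lemma torus_sets [measurable]: "torus \<in> sets borel"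
  unfolding torus_def circ_def by (intro borel_closed closed_Times) auto

lemma sets_circle_measure [simp, measurable_cong]: "sets \<mu> = sets borel"
  by (simp add: circle_measure_def)

lemma space_circle_measure [simp]: "space \<mu> = UNIV"
  by (simp add: circle_measure_def)

lemma prob_space_circle: "prob_space \<mu>"
proof
  have "emeasure \<mu> (space \<mu>) = (\<integral>\<^sup>+x. ennreal (1 / (2 * pi)) * indicator circ x \<partial>lborel)"
    unfolding circle_measure_def
    by (subst emeasure_density) (auto intro!: nn_integral_cong split: split_indicator)
  also have "\<dots> = ennreal (1 / (2 * pi)) * emeasure lborel circ"
    by (simp add: nn_integral_cmult_indicator)
  also have "\<dots> = 1"
    by (simp add: circ_def ennreal_mult[symmetric])
  finally show "emeasure \<mu> (space \<mu>) = 1" .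
qed

interpretation circle: prob_space \<mu> by (rule prob_space_circle)
interpretation torus: pair_prob_space \<mu> \<mu> ..

lemma torus_measure_eq: "\<mu>\<^sub>2 = density lborel (\<lambda>p. ennreal (indicator torus p / (4 * pi\<^sup>2)))"
proof -
  have "sigma_finite_measure (density lborel (\<lambda>x. ennreal (indicator circ x / (2 * pi))))"
    using circle.sigma_finite_measure_axioms by (simp add: circle_measure_def)
  then have "\<mu>\<^sub>2 = density (lborel \<Otimes>\<^sub>M lborel)
      (\<lambda>(x,y). ennreal (indicator circ x / (2 * pi)) * ennreal (indicator circ y / (2 * pi)))"
    unfolding circle_measure_def
    by (intro pair_measure_density) (auto intro: lborel.sigma_finite_measure_axioms)
  also have "\<dots> = density lborel (\<lambda>p. ennreal (indicator torus p / (4 * pi\<^sup>2)))"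
    unfolding lborel_prod
    by (rule arg_cong[where f = "density lborel"])
       (auto simp: fun_eq_iff torus_def ennreal_mult[symmetric] power2_eq_square split: split_indicator)
  finally show ?thesis .
qed

lemma measurable_torus: "f \<in> borel_measurable lborel \<longleftrightarrow> f \<in> borel_measurable \<mu>\<^sub>2"
  by (simp add: torus_measure_eq)

lemma measurable_circle: "f \<in> borel_measurable lborel \<longleftrightarrow> f \<in> borel_measurable \<mu>"
  by (simp add: circle_measure_def)

section \<open>Square-integrable functions and Fourier coefficients for the normalised
  measures\<close>

definition sq_int :: "'a measure \<Rightarrow> ('a \<Rightarrow> complex) \<Rightarrow> bool" where
  "sq_int M f \<longleftrightarrow> f \<in> borel_measurable M \<and> integrable M (\<lambda>x. (cmod (f x))\<^sup>2)"

lemma sq_int_measurable: "sq_int M f \<Longrightarrow> f \<in> borel_measurable M"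
  by (simp add: sq_int_def)

lemma nn_integral_torus:
  assumes "f \<in> borel_measurable \<mu>\<^sub>2"
  shows "(\<integral>\<^sup>+p. ennreal ((cmod (f p))\<^sup>2) \<partial>\<mu>\<^sub>2) =
    ennreal (1 / (4 * pi\<^sup>2)) * (\<integral>\<^sup>+ p\<in>torus. ennreal ((cmod (f p))\<^sup>2) \<partial>lborel)"
proof -
  have [measurable]: "f \<in> borel_measurable borel"
    using assms by (simp add: measurable_torus[symmetric])
  show ?thesis
    unfolding torus_measure_eq
    by (subst nn_integral_density, simp, simp, subst nn_integral_cmult[symmetric])
       (auto intro!: nn_integral_cong split: split_indicator)
qed

lemma nn_integral_circle:
  assumes "f \<in> borel_measurable \<mu>"
  shows "(\<integral>\<^sup>+p. ennreal ((cmod (f p))\<^sup>2) \<partial>\<mu>) =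
    ennreal (1 / (2 * pi)) * (\<integral>\<^sup>+ p\<in>circ. ennreal ((cmod (f p))\<^sup>2) \<partial>lborel)"
proof -
  have [measurable]: "f \<in> borel_measurable borel"
    using assms by (simp add: measurable_circle[symmetric])
  show ?thesis
    unfolding circle_measure_def
    by (subst nn_integral_density, simp, simp, subst nn_integral_cmult[symmetric])
       (auto intro!: nn_integral_cong split: split_indicator)
qed

lemma L2_1_iff: "L2_1 f \<longleftrightarrow> sq_int \<mu> f"
proof (cases "f \<in> borel_measurable \<mu>")
  case True
  then show ?thesis
    by (auto simp: L2_1_def sq_int_def measurable_circle[symmetric, simplified] integrable_iff_bounded nn_integral_circle
        ennreal_mult_less_top)
qed (auto simp: L2_1_def sq_int_def measurable_circle)

lemma L2_2_iff: "L2_2 f \<longleftrightarrow> sq_int \<mu>\<^sub>2 f"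
proof (cases "f \<in> borel_measurable \<mu>\<^sub>2")
  case True
  then show ?thesis
    by (auto simp: L2_2_def sq_int_def measurable_torus[symmetric, simplified] integrable_iff_bounded nn_integral_torus
        ennreal_mult_less_top)
qed (auto simp: L2_2_def sq_int_def measurable_torus[symmetric, simplified])

lemma norm2_eq:
  assumes "f \<in> borel_measurable \<mu>\<^sub>2"
  shows "norm2 f = sqrt (\<integral>p. (cmod (f p))\<^sup>2 \<partial>\<mu>\<^sub>2)"
  using assms by (simp add: norm2_def integral_eq_nn_integral nn_integral_torus enn2real_mult)

lemma integral_torus:
  fixes f :: "real \<times> real \<Rightarrow> complex"
  assumes "f \<in> borel_measurable \<mu>\<^sub>2"
  shows "(LINT p:torus|lborel. f p) / of_real (4 * pi\<^sup>2) = (\<integral>p. f p \<partial>\<mu>\<^sub>2)"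
proof -
  have [measurable]: "f \<in> borel_measurable borel"
    using assms by (simp add: measurable_torus[symmetric])
  have "(\<integral>p. f p \<partial>\<mu>\<^sub>2) = (\<integral>p. (indicator torus p / (4 * pi\<^sup>2)) *\<^sub>R f p \<partial>lborel)"
    unfolding torus_measure_eq by (subst integral_density) auto
  also have "\<dots> = (\<integral>p. (indicator torus p *\<^sub>R f p) / of_real (4 * pi\<^sup>2) \<partial>lborel)"
    by (intro Bochner_Integration.integral_cong) (auto split: split_indicator simp: scaleR_conv_of_real)
  also have "\<dots> = (\<integral>p. (indicator torus p *\<^sub>R f p) \<partial>lborel) / of_real (4 * pi\<^sup>2)"
    by (rule integral_divide_zero)
  finally show ?thesis
    by (simp add: set_lebesgue_integral_def)
qed

lemma integral_circle:
  fixes f :: "real \<Rightarrow> complex"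
  assumes "f \<in> borel_measurable \<mu>"
  shows "(LINT p:circ|lborel. f p) / of_real (2 * pi) = (\<integral>p. f p \<partial>\<mu>)"
proof -
  have [measurable]: "f \<in> borel_measurable borel"
    using assms by (simp add: measurable_circle[symmetric])
  have "(\<integral>p. f p \<partial>\<mu>) = (\<integral>p. (indicator circ p / (2 * pi)) *\<^sub>R f p \<partial>lborel)"
    unfolding circle_measure_def by (subst integral_density) auto
  also have "\<dots> = (\<integral>p. (indicator circ p *\<^sub>R f p) / of_real (2 * pi) \<partial>lborel)"
    by (intro Bochner_Integration.integral_cong) (auto split: split_indicator simp: scaleR_conv_of_real)
  also have "\<dots> = (\<integral>p. (indicator circ p *\<^sub>R f p) \<partial>lborel) / of_real (2 * pi)"
    by (rule integral_divide_zero)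
  finally show ?thesis
    by (simp add: set_lebesgue_integral_def)
qed

lemma cnj_measurable [measurable]: "cnj \<in> borel_measurable borel"
  by (intro borel_measurable_continuous_onI continuous_intros)

lemma cis_measurable [measurable]: "cis \<in> borel_measurable borel"
  by (intro borel_measurable_continuous_onI continuous_intros)

definition coeff1 :: "(real \<Rightarrow> complex) \<Rightarrow> int \<Rightarrow> complex" where
  "coeff1 f m = (\<integral>x. f x * cis (- (of_int m * x)) \<partial>\<mu>)"

text \<open>The two exponentials remain separate factors, so that Fubini or a multiplier in one
  coordinate acts on one of them alone.\<close>

definition coeff2 :: "(real \<times> real \<Rightarrow> complex) \<Rightarrow> int \<Rightarrow> int \<Rightarrow> complex" where
  "coeff2 f m n = (\<integral>p. f p * cis (- (of_int m * fst p)) * cis (- (of_int n * snd p)) \<partial>\<mu>\<^sub>2)"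

lemma fourier1_eq:
  assumes [measurable]: "f \<in> borel_measurable \<mu>"
  shows "fourier1 f m = coeff1 f m"
  unfolding fourier1_def coeff1_def by (rule integral_circle) measurable

lemma fourier2_eq:
  assumes [measurable]: "f \<in> borel_measurable \<mu>\<^sub>2"
  shows "fourier2 f m n = coeff2 f m n"
  unfolding fourier2_def coeff2_def
  by (subst integral_torus, measurable) (auto simp: mult.assoc cis_mult)

lemma inner2_eq:
  assumes [measurable]: "f \<in> borel_measurable \<mu>\<^sub>2" "g \<in> borel_measurable \<mu>\<^sub>2"
  shows "inner2 f g = (\<integral>p. f p * cnj (g p) \<partial>\<mu>\<^sub>2)"
  unfolding inner2_def by (rule integral_torus) measurable

lemma H2_1_iff: "f \<in> H2_1 \<longleftrightarrow> sq_int \<mu> f \<and> (\<forall>m<0. coeff1 f m = 0)"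
  using sq_int_measurable[of \<mu> f] by (auto simp: H2_1_def L2_1_iff fourier1_eq)

lemma H2_2_iff:
  "f \<in> H2_2 \<longleftrightarrow> sq_int \<mu>\<^sub>2 f \<and> (\<forall>m n. m < 0 \<or> n < 0 \<longrightarrow> coeff2 f m n = 0)"
  using sq_int_measurable[of \<mu>\<^sub>2 f] by (auto simp: H2_2_def L2_2_iff fourier2_eq)

lemma sq_int_bound:
  assumes [measurable]: "f \<in> borel_measurable M" and "sq_int M g" "AE x in M. cmod (f x) \<le> C * cmod (g x)"
  shows "sq_int M f"
proof -
  note [measurable] = sq_int_measurable[OF assms(2)]
  have "integrable M (\<lambda>x. C\<^sup>2 * (cmod (g x))\<^sup>2)"
    using assms(2) by (simp add: sq_int_def)
  then have "integrable M (\<lambda>x. (cmod (f x))\<^sup>2)"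
  proof (rule Bochner_Integration.integrable_bound)
    show "AE x in M. norm ((cmod (f x))\<^sup>2) \<le> norm (C\<^sup>2 * (cmod (g x))\<^sup>2)"
      using assms(3)
    proof eventually_elim
      case (elim x)
      then have "(cmod (f x))\<^sup>2 \<le> (C * cmod (g x))\<^sup>2"
        by (intro power_mono) auto
      then show ?case by (simp add: power_mult_distrib)
    qed
  qed simp
  then show ?thesis by (simp add: sq_int_def)
qed

lemma sq_int_bounded_mult:
  assumes [measurable]: "q \<in> borel_measurable M" and "AE x in M. cmod (q x) \<le> C" "sq_int M f"
  shows "sq_int M (\<lambda>x. q x * f x)"
proof (rule sq_int_bound[OF _ assms(3)])
  show "AE x in M. cmod (q x * f x) \<le> C * cmod (f x)"
    using assms(2) by eventually_elim (simp add: norm_mult mult_right_mono)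
qed (use sq_int_measurable[OF assms(3)] in measurable)

lemma sq_int_cmult: "sq_int M f \<Longrightarrow> sq_int M (\<lambda>x. c * f x)"
  by (rule sq_int_bounded_mult[where C = "cmod c"]) auto

lemma sq_int_cnj: "sq_int M f \<Longrightarrow> sq_int M (\<lambda>x. cnj (f x))"
  by (rule sq_int_bound[where g = f and C = 1]) (use sq_int_measurable[of M f] in \<open>simp_all\<close>)

lemma sq_int_add:
  assumes "sq_int M f" "sq_int M g"
  shows "sq_int M (\<lambda>x. f x + g x)"
proof -
  note [measurable] = assms[THEN sq_int_measurable]
  have "integrable M (\<lambda>x. 2 * (cmod (f x))\<^sup>2 + 2 * (cmod (g x))\<^sup>2)"
    using assms by (simp add: sq_int_def)
  then have "integrable M (\<lambda>x. (cmod (f x + g x))\<^sup>2)"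
  proof (rule Bochner_Integration.integrable_bound)
    have "(cmod (f x + g x))\<^sup>2 \<le> 2 * (cmod (f x))\<^sup>2 + 2 * (cmod (g x))\<^sup>2" for x
    proof -
      have "(cmod (f x + g x))\<^sup>2 \<le> (cmod (f x) + cmod (g x))\<^sup>2"
        by (intro power_mono norm_triangle_ineq) auto
      also have "\<dots> \<le> 2 * (cmod (f x))\<^sup>2 + 2 * (cmod (g x))\<^sup>2"
        using sum_squares_ge_zero[of "cmod (f x) - cmod (g x)" 0]
        by (simp add: power2_eq_square algebra_simps)
      finally show ?thesis .
    qed
    then show "AE x in M. norm ((cmod (f x + g x))\<^sup>2) \<le> norm (2 * (cmod (f x))\<^sup>2 + 2 * (cmod (g x))\<^sup>2)"
      by simp
  qed simp
  then show ?thesis by (simp add: sq_int_def)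
qed

lemma sq_int_mult_integrable:
  assumes "sq_int M f" "sq_int M g"
  shows "integrable M (\<lambda>x. f x * g x)"
proof -
  note [measurable] = assms[THEN sq_int_measurable]
  have "integrable M (\<lambda>x. (cmod (f x))\<^sup>2 + (cmod (g x))\<^sup>2)"
    using assms by (simp add: sq_int_def)
  then show ?thesis
  proof (rule Bochner_Integration.integrable_bound)
    have "cmod (f x) * cmod (g x) \<le> (cmod (f x))\<^sup>2 + (cmod (g x))\<^sup>2" for x
    proof -
      have "2 * (cmod (f x) * cmod (g x)) \<le> (cmod (f x))\<^sup>2 + (cmod (g x))\<^sup>2"
        using sum_squares_bound[of "cmod (f x)" "cmod (g x)"] by simp
      moreover have "0 \<le> cmod (f x) * cmod (g x)" by simp
      ultimately show ?thesis by linarith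
    qed
    then show "AE x in M. norm (f x * g x) \<le> norm ((cmod (f x))\<^sup>2 + (cmod (g x))\<^sup>2)"
      by (simp add: norm_mult)
  qed simp
qed

lemma (in finite_measure) sq_int_bounded:
  assumes [measurable]: "q \<in> borel_measurable M" and "AE x in M. cmod (q x) \<le> C"
  shows "sq_int M q"
proof -
  have "sq_int M (\<lambda>x. 1)" by (simp add: sq_int_def)
  from sq_int_bounded_mult[OF assms this] show ?thesis by simp
qed

lemma (in finite_measure) sq_int_integrable:
  assumes "sq_int M f"
  shows "integrable M f"
  using sq_int_mult_integrable[OF assms, of "\<lambda>_. 1"] by (simp add: sq_int_def)

lemma sq_int_sum: "(\<And>i. i \<in> I \<Longrightarrow> sq_int M (f i)) \<Longrightarrow> sq_int M (\<lambda>x. \<Sum>i\<in>I. f i x)"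
proof (induction I rule: infinite_finite_induct)
  case (insert i I)
  then show ?case using sq_int_add[of M "f i" "\<lambda>x. \<Sum>i\<in>I. f i x"] by simp
qed (auto simp: sq_int_def)

subsection \<open>Multiplication by bounded analytic functions\<close>

lemma integral_swap:
  fixes f :: "real \<times> real \<Rightarrow> complex"
  assumes "f \<in> borel_measurable \<mu>\<^sub>2"
  shows "(\<integral>p. f (prod.swap p) \<partial>\<mu>\<^sub>2) = (\<integral>p. f p \<partial>\<mu>\<^sub>2)"
  using torus.integral_product_swap[OF assms] by (simp add: prod.swap_def case_prod_unfold)

lemma sq_int_swap:
  assumes "sq_int \<mu>\<^sub>2 f"
  shows "sq_int \<mu>\<^sub>2 (\<lambda>p. f (prod.swap p))"
proof -
  note [measurable] = sq_int_measurable[OF assms]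
  have "(\<lambda>p. f (prod.swap p)) \<in> borel_measurable \<mu>\<^sub>2"
    unfolding prod.swap_def by measurable
  then show ?thesis
    using torus.integrable_product_swap[of "\<lambda>p. (cmod (f p))\<^sup>2"] assms
    by (simp add: sq_int_def prod.swap_def case_prod_unfold)
qed

lemma coeff2_swap:
  assumes [measurable]: "f \<in> borel_measurable \<mu>\<^sub>2"
  shows "coeff2 (\<lambda>p. f (prod.swap p)) m n = coeff2 f n m"
proof -
  have "coeff2 (\<lambda>p. f (prod.swap p)) m n =
    (\<integral>p. (\<lambda>p. f p * cis (- (of_int n * fst p)) * cis (- (of_int m * snd p))) (prod.swap p) \<partial>\<mu>\<^sub>2)"
    unfolding coeff2_def by (intro Bochner_Integration.integral_cong) (auto simp: mult_ac)
  also have "\<dots> = coeff2 f n m"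
    unfolding coeff2_def by (rule integral_swap) measurable
  finally show ?thesis .
qed

text \<open>Exchanging the coordinates only exchanges the two indices. Many results below are proved
  for one coordinate and carried to the other in this way.\<close>

lemma H2_2_swap: "f \<in> H2_2 \<Longrightarrow> (\<lambda>p. f (prod.swap p)) \<in> H2_2"
  by (auto simp: H2_2_iff sq_int_swap coeff2_swap sq_int_measurable)

lemma H2_2_sq_int: "f \<in> H2_2 \<Longrightarrow> sq_int \<mu>\<^sub>2 f"
  by (simp add: H2_2_iff)

lemma H2_1_sq_int: "f \<in> H2_1 \<Longrightarrow> sq_int \<mu> f"
  by (simp add: H2_1_iff)

lemma integrable_unimodular:
  fixes f q :: "'a \<Rightarrow> complex"
  assumes [measurable]: "q \<in> borel_measurable M" and "integrable M f" "\<And>x. cmod (q x) \<le> 1"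
  shows "integrable M (\<lambda>x. f x * q x)"
  using assms(2)
  by (rule Bochner_Integration.integrable_bound)
     (use assms(2,3) in \<open>auto simp: norm_mult mult_left_le\<close>)

lemma integrable_coeff2:
  assumes "integrable \<mu>\<^sub>2 f"
  shows "integrable \<mu>\<^sub>2 (\<lambda>p. f p * cis (- (of_int m * fst p)) * cis (- (of_int n * snd p)))"
  by (intro integrable_unimodular assms) auto

lemma coeff2_add:
  "integrable \<mu>\<^sub>2 f \<Longrightarrow> integrable \<mu>\<^sub>2 g \<Longrightarrow> coeff2 (\<lambda>p. f p + g p) m n = coeff2 f m n + coeff2 g m n"
  unfolding coeff2_def distrib_right
  by (intro Bochner_Integration.integral_add integrable_coeff2)

lemma coeff2_cmult: "coeff2 (\<lambda>p. c * f p) m n = c * coeff2 f m n"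
  unfolding coeff2_def mult.assoc by (rule integral_mult_right_zero)

lemma coeff2_zero [simp]: "coeff2 (\<lambda>p. 0) m n = 0"
  by (simp add: coeff2_def)

lemma coeff2_sum:
  "(\<And>i. i \<in> I \<Longrightarrow> integrable \<mu>\<^sub>2 (f i)) \<Longrightarrow> coeff2 (\<lambda>p. \<Sum>i\<in>I. f i p) m n = (\<Sum>i\<in>I. coeff2 (f i) m n)"
  by (induction I rule: infinite_finite_induct) (auto simp: coeff2_add)

lemma coeff2_mult_cis_power:
  "coeff2 (\<lambda>p. cis (fst p) ^ k * f p) m n = coeff2 f (m - int k) n"
  unfolding coeff2_def
proof (intro Bochner_Integration.integral_cong refl)
  fix p :: "real \<times> real"
  have "cis (fst p) ^ k * cis (- (of_int m * fst p)) = cis (- (of_int (m - int k) * fst p))"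
    by (simp add: Complex.DeMoivre cis_mult algebra_simps)
  then show "cis (fst p) ^ k * f p * cis (- (of_int m * fst p)) * cis (- (of_int n * snd p)) =
    f p * cis (- (of_int (m - int k) * fst p)) * cis (- (of_int n * snd p))"
    by (metis mult.assoc mult.commute)
qed

lemma H2_2_0 [simp]: "(\<lambda>p. 0) \<in> H2_2"
  by (simp add: H2_2_iff sq_int_def)

lemma H2_2_add: "f \<in> H2_2 \<Longrightarrow> g \<in> H2_2 \<Longrightarrow> (\<lambda>p. f p + g p) \<in> H2_2"
  by (auto simp: H2_2_iff sq_int_add coeff2_add torus.sq_int_integrable)

lemma H2_2_cmult: "f \<in> H2_2 \<Longrightarrow> (\<lambda>p. c * f p) \<in> H2_2"
  by (auto simp: H2_2_iff sq_int_cmult coeff2_cmult)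

lemma H2_2_diff: "f \<in> H2_2 \<Longrightarrow> g \<in> H2_2 \<Longrightarrow> (\<lambda>p. f p - g p) \<in> H2_2"
  using H2_2_add[OF _ H2_2_cmult, of f g "-1"] by simp

lemma H2_2_sum: "(\<And>i. i \<in> I \<Longrightarrow> f i \<in> H2_2) \<Longrightarrow> (\<lambda>p. \<Sum>i\<in>I. f i p) \<in> H2_2"
  by (induction I rule: infinite_finite_induct) (auto intro: H2_2_add)

lemma AE_circle_fst:
  assumes "AE x in \<mu>. P x"
  shows "AE p in \<mu>\<^sub>2. P (fst p)"
proof -
  have "AE x in distr \<mu>\<^sub>2 \<mu> fst. P x"
    unfolding circle.distr_pair_fst by (rule assms)
  then show ?thesis by (rule AE_distrD[rotated]) measurable
qed

lemma AE_circle: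
  assumes "AE x in lborel. x \<in> circ \<longrightarrow> P x"
  shows "AE x in \<mu>. P x"
  unfolding circle_measure_def using assms
  by (subst AE_density) (auto split: split_indicator simp: indicator_def elim!: eventually_mono)

text \<open>The bound on the disc passes to radial limits, so one constant serves for
  \<open>g\<close> and, a.e., for \<open>G\<close>.\<close>

lemma Hinf_bound:
  assumes "Hinf g G"
  obtains C where "C \<ge> 0" "\<And>z. cmod z < 1 \<Longrightarrow> cmod (g z) \<le> C" "AE x in \<mu>. cmod (G x) \<le> C"
proof -
  obtain C where C: "C > 0" "\<And>z. z \<in> ball 0 1 \<Longrightarrow> cmod (g z) \<le> C"
    using assms unfolding Hinf_def bounded_pos by auto
  have "AE x in \<mu>. ((\<lambda>r. g (of_real r * cis x)) \<longlongrightarrow> G x) (at_left 1)"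
    using assms by (intro AE_circle) (simp add: Hinf_def)
  then have "AE x in \<mu>. cmod (G x) \<le> C"
  proof eventually_elim
    case (elim x)
    show ?case
    proof (rule tendsto_le[OF _ tendsto_const tendsto_norm[OF elim]])
      have "\<forall>\<^sub>F r in at_left (1::real). r \<in> {0<..<1}"
        by (rule eventually_at_leftI[of 0]) auto
      then show "\<forall>\<^sub>F r in at_left 1. cmod (g (of_real r * cis x)) \<le> C"
        by eventually_elim (rule C, simp add: norm_mult)
    qed simp
  qed
  then show ?thesis using that[of C] C by auto
qed

lemma Hinf_measurable: "Hinf g G \<Longrightarrow> G \<in> borel_measurable \<mu>"
  by (simp add: Hinf_def circle_measure_def)

text \<open>After multiplication by the k-th power of e^{ix} the coefficient at (m, n) is the old
  one at (m - k, n), and a negative entry stays negative.\<close>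

lemma coeff2_polynomial_mult:
  assumes f: "integrable \<mu>\<^sub>2 f" "\<And>m n. m < 0 \<or> n < 0 \<Longrightarrow> coeff2 f m n = 0" and mn: "m < 0 \<or> n < 0"
  shows "coeff2 (\<lambda>p. (\<Sum>k<N. a k * cis (fst p) ^ k) * f p) m n = 0"
proof -
  have "coeff2 (\<lambda>p. (\<Sum>k<N. a k * cis (fst p) ^ k) * f p) m n =
      coeff2 (\<lambda>p. \<Sum>k<N. a k * (cis (fst p) ^ k * f p)) m n"
    by (simp add: sum_distrib_right mult.assoc)
  also have "\<dots> = (\<Sum>k<N. coeff2 (\<lambda>p. a k * (cis (fst p) ^ k * f p)) m n)"
  proof (rule coeff2_sum)
    fix k
    have "integrable \<mu>\<^sub>2 (\<lambda>p. f p * cis (fst p) ^ k)"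
      by (rule integrable_unimodular[OF _ f(1)]) (auto simp: norm_power)
    then show "integrable \<mu>\<^sub>2 (\<lambda>p. a k * (cis (fst p) ^ k * f p))"
      by (simp add: mult.commute)
  qed
  also have "\<dots> = 0"
    using mn by (intro sum.neutral) (auto simp: coeff2_cmult coeff2_mult_cis_power intro!: f(2))
  finally show ?thesis .
qed

text \<open>Dominated convergence with majorant C |f|. It serves both the partial sums of a power
  series and the passage to radial limits.\<close>

lemma coeff2_tendsto:
  assumes f: "integrable \<mu>\<^sub>2 f" and [measurable]: "\<And>i. q i \<in> borel_measurable \<mu>" "q' \<in> borel_measurable \<mu>"
    and "\<And>i x. cmod (q i x) \<le> C" and lim: "AE x in \<mu>. (\<lambda>i. q i x) \<longlonglongrightarrow> q' x"
  shows "(\<lambda>i. coeff2 (\<lambda>p. q i (fst p) * f p) m n) \<longlonglongrightarrow> coeff2 (\<lambda>p. q' (fst p) * f p) m n"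
proof -
  note [measurable] = borel_measurable_integrable[OF f]
  show ?thesis
    unfolding coeff2_def
  proof (rule integral_dominated_convergence[where w = "\<lambda>p. C * cmod (f p)"])
    show "AE p in \<mu>\<^sub>2. (\<lambda>i. q i (fst p) * f p * cis (- (of_int m * fst p)) * cis (- (of_int n * snd p)))
      \<longlonglongrightarrow> q' (fst p) * f p * cis (- (of_int m * fst p)) * cis (- (of_int n * snd p))"
      using AE_circle_fst[OF lim] by eventually_elim (intro tendsto_intros)
    show "AE p in \<mu>\<^sub>2. norm (q i (fst p) * f p * cis (- (of_int m * fst p)) * cis (- (of_int n * snd p)))
      \<le> C * cmod (f p)" for i
      using assms(4) by (auto simp: norm_mult intro!: mult_right_mono)
  qed (use f in auto)
qed

text \<open>On the circle of radius \<open>r\<close> the Taylor series of \<open>g\<close> converges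
  absolutely, so the polynomial case passes to the limit.\<close>

lemma coeff2_dilation_mult:
  assumes g: "g holomorphic_on ball 0 1" and r: "0 < r" "r < 1"
    and f: "integrable \<mu>\<^sub>2 f" "\<And>m n. m < 0 \<or> n < 0 \<Longrightarrow> coeff2 f m n = 0" and mn: "m < 0 \<or> n < 0"
  shows "coeff2 (\<lambda>p. g (of_real r * cis (fst p)) * f p) m n = 0"
proof -
  define a where "a k = (deriv ^^ k) g 0 / fact k" for k
  have sums: "(\<lambda>k. a k * z ^ k) sums g z" if "cmod z < 1" for z
    using holomorphic_power_series[OF g, of z] that by (simp add: a_def)
  \<comment> \<open>Any point strictly between \<open>r\<close> and 1 would do: convergence of the
    series at \<open>s\<close> gives absolute convergence at \<open>r\<close>.\<close>
  define s where "s = (1 + r) / 2"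
  have s: "r < s" "s < 1" using r by (auto simp: s_def)
  have "summable (\<lambda>k. cmod (a k * of_real r ^ k))"
    using sums[of "of_real s"] s r
    by (intro powser_insidea[of a "of_real s"]) (auto simp: sums_iff)
  then have sm: "summable (\<lambda>k. cmod (a k) * r ^ k)"
    using r by (simp add: norm_mult norm_power)
  define q where "q N x = (\<Sum>k<N. (a k * of_real r ^ k) * cis x ^ k)" for N x
  have "(\<lambda>N. coeff2 (\<lambda>p. q N (fst p) * f p) m n) \<longlonglongrightarrow> coeff2 (\<lambda>p. g (of_real r * cis (fst p)) * f p) m n"
  proof (rule coeff2_tendsto[OF f(1), where C = "\<Sum>k. cmod (a k) * r ^ k" and q' = "\<lambda>x. g (of_real r * cis x)"])
    show "q i \<in> borel_measurable \<mu>" for i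
      unfolding q_def by measurable
    have "continuous_on UNIV (\<lambda>x. g (of_real r * cis x))"
      using r by (intro continuous_on_compose2[OF holomorphic_on_imp_continuous_on[OF g]] continuous_intros)
        (auto simp: norm_mult)
    note [measurable] = borel_measurable_continuous_onI[OF this]
    show "(\<lambda>x. g (of_real r * cis x)) \<in> borel_measurable \<mu>"
      by measurable
    show "cmod (q i x) \<le> (\<Sum>k. cmod (a k) * r ^ k)" for i x
    proof -
      have "cmod (q i x) \<le> (\<Sum>k<i. cmod (a k) * r ^ k)"
        unfolding q_def using r by (intro sum_norm_le) (simp add: norm_mult norm_power)
      also have "\<dots> \<le> (\<Sum>k. cmod (a k) * r ^ k)"
        using sm r by (intro sum_le_suminf) auto
      finally show ?thesis .
    qed
    have "(\<lambda>N. q N x) \<longlonglongrightarrow> g (of_real r * cis x)" for x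
      using sums[of "of_real r * cis x"] r
      by (simp add: q_def sums_def norm_mult power_mult_distrib mult.assoc)
    then show "AE x in \<mu>. (\<lambda>i. q i x) \<longlonglongrightarrow> g (of_real r * cis x)" by simp
  qed
  moreover have "coeff2 (\<lambda>p. q N (fst p) * f p) m n = 0" for N
    unfolding q_def by (rule coeff2_polynomial_mult[OF f mn])
  ultimately show ?thesis
    by (simp add: LIMSEQ_const_iff)
qed

text \<open>\<open>G\<close> is only an a.e. radial limit, but the dilations g(r e^{ix}) share the
  bound of \<open>g\<close>, so the vanishing coefficients survive as r tends to 1.\<close>

lemma H2_2_mult_fst:
  assumes G: "Hinf g G" and f: "f \<in> H2_2"
  shows "(\<lambda>p. G (fst p) * f p) \<in> H2_2"
proof -
  obtain C where C: "\<And>z. cmod z < 1 \<Longrightarrow> cmod (g z) \<le> C" "AE x in \<mu>. cmod (G x) \<le> C"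
    using Hinf_bound[OF G] by metis
  note [measurable] = Hinf_measurable[OF G]
  note f' = torus.sq_int_integrable[OF H2_2_sq_int[OF f]]
  have hol: "g holomorphic_on ball 0 1" using G by (simp add: Hinf_def)
  have "sq_int \<mu>\<^sub>2 (\<lambda>p. G (fst p) * f p)"
    by (rule sq_int_bounded_mult[OF _ AE_circle_fst[OF C(2)] H2_2_sq_int[OF f]]) measurable
  moreover have "coeff2 (\<lambda>p. G (fst p) * f p) m n = 0" if mn: "m < 0 \<or> n < 0" for m n
  proof -
    \<comment> \<open>Radii in the open interval (0, 1), starting at 1/2; a sequence, because
      dominated convergence is applied along one.\<close>
    define r :: "nat \<Rightarrow> real" where "r k = 1 - inverse (real (Suc (Suc k)))" for k
    have r: "0 < r k" "r k < 1" for k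
      by (auto simp: r_def field_simps)
    have "r \<longlonglongrightarrow> 1 - 0"
      unfolding r_def
      using LIMSEQ_Suc[OF LIMSEQ_inverse_real_of_nat] by (intro tendsto_intros) (simp add: o_def)
    then have lim: "filterlim r (at_left 1) sequentially"
      by (simp add: filterlim_at r(2) less_imp_neq[OF r(2)])
    have "(\<lambda>i. coeff2 (\<lambda>p. g (of_real (r i) * cis (fst p)) * f p) m n) \<longlonglongrightarrow> coeff2 (\<lambda>p. G (fst p) * f p) m n"
    proof (rule coeff2_tendsto[OF f', where q = "\<lambda>i x. g (of_real (r i) * cis x)" and C = C])
      fix i
      have "continuous_on UNIV (\<lambda>x. g (of_real (r i) * cis x))"
        using r[of i] by (intro continuous_on_compose2[OF holomorphic_on_imp_continuous_on[OF hol]] continuous_intros)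
          (auto simp: norm_mult)
      note [measurable] = borel_measurable_continuous_onI[OF this]
      show "(\<lambda>x. g (of_real (r i) * cis x)) \<in> borel_measurable \<mu>"
        by measurable
      show "cmod (g (of_real (r i) * cis x)) \<le> C" for x
        using r[of i] by (intro C) (simp add: norm_mult)
    next
      have "AE x in \<mu>. ((\<lambda>r. g (of_real r * cis x)) \<longlongrightarrow> G x) (at_left 1)"
        using G by (intro AE_circle) (simp add: Hinf_def)
      then show "AE x in \<mu>. (\<lambda>i. g (of_real (r i) * cis x)) \<longlonglongrightarrow> G x"
        by eventually_elim (erule filterlim_compose[OF _ lim])
    qed simp
    moreover have "coeff2 (\<lambda>p. g (of_real (r i) * cis (fst p)) * f p) m n = 0" for i
      using f by (intro coeff2_dilation_mult[OF hol r f' _ mn]) (auto simp: H2_2_iff)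
    ultimately show ?thesis
      by (simp add: LIMSEQ_const_iff)
  qed
  ultimately show ?thesis by (simp add: H2_2_iff)
qed

lemma H2_2_mult_snd:
  assumes "Hinf g G" and "f \<in> H2_2"
  shows "(\<lambda>p. G (snd p) * f p) \<in> H2_2"
  using H2_2_swap[OF H2_2_mult_fst[OF assms(1) H2_2_swap[OF assms(2)]]] by simp

lemma coeff1_add:
  assumes "integrable \<mu> f" "integrable \<mu> g"
  shows "coeff1 (\<lambda>x. f x + g x) m = coeff1 f m + coeff1 g m"
  unfolding coeff1_def distrib_right
  by (intro Bochner_Integration.integral_add integrable_unimodular assms) auto

lemma coeff1_cmult: "coeff1 (\<lambda>x. c * f x) m = c * coeff1 f m"
  unfolding coeff1_def mult.assoc by (rule integral_mult_right_zero)

lemma coeff1_mult_cis: "coeff1 (\<lambda>x. cis (of_int k * x) * f x) m = coeff1 f (m - k)"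
  unfolding coeff1_def
proof (intro Bochner_Integration.integral_cong refl)
  fix x
  have "cis (of_int k * x) * cis (- (of_int m * x)) = cis (- (of_int (m - k) * x))"
    by (simp add: cis_mult algebra_simps)
  then show "cis (of_int k * x) * f x * cis (- (of_int m * x)) = f x * cis (- (of_int (m - k) * x))"
    by (metis mult.assoc mult.commute)
qed

lemma coeff1_one: "coeff1 (\<lambda>x. 1) m = (if m = 0 then 1 else 0)"
proof (cases "m = 0")
  case True
  then show ?thesis using circle.prob_space by (simp add: coeff1_def)
next
  case False
  define F where "F x = cis (- (of_int m * x)) / (- \<i> * of_int m)" for x
  have "coeff1 (\<lambda>x. 1) m = (LINT x:circ|lborel. cis (- (of_int m * x))) / of_real (2 * pi)"
    unfolding coeff1_def by (subst integral_circle) auto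
  also have "(LINT x:circ|lborel. cis (- (of_int m * x))) = F (2 * pi) - F 0"
    unfolding set_lebesgue_integral_def circ_def
  proof (rule integral_FTC_Icc)
    show "(F has_vector_derivative cis (- (of_int m * x))) (at x within {0..2*pi})" for x
      unfolding F_def has_vector_derivative_def using False
      by (auto intro!: derivative_eq_intros simp: fun_eq_iff scaleR_conv_of_real complex_eq_iff)
  qed (auto intro!: continuous_intros)
  also have "F (2 * pi) = F 0"
  proof -
    have "cis (- (of_int m * (2 * pi))) = cis (2 * pi * of_int (- m))" by (simp add: mult_ac)
    also have "\<dots> = 1" by (rule cis_multiple_2pi) auto
    finally show ?thesis by (simp add: F_def)
  qed
  finally show ?thesis using False by simp
qed

subsection \<open>Uniqueness of Fourier coefficients\<close>

text \<open>On the circle a real linear functional is a combination of e^{ix} and e^{-ix}, so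
  multiplying by it only shifts and combines coefficients, all of which are zero. With
  \<open>f\<close> arbitrary in the induction, a product of polynomials is handled one factor at a
  time.\<close>

lemma coeff1_zero_mult_polynomial:
  assumes "real_polynomial_function p" "integrable \<mu> f" "\<And>m. coeff1 f m = 0"
  shows "integrable \<mu> (\<lambda>x. of_real (p (cis x)) * f x) \<and> (\<forall>m. coeff1 (\<lambda>x. of_real (p (cis x)) * f x) m = 0)"
  using assms
proof (induction p arbitrary: f rule: real_polynomial_function.induct)
  case (linear p)
  \<comment> \<open>The coefficients of e^{ix} and e^{-ix} in cos x p(1) + sin x p(i), by Euler's
    formulas.\<close>
  define \<alpha> \<beta> where "\<alpha> = (of_real (p 1) - \<i> * of_real (p \<i>)) / 2" and "\<beta> = (of_real (p 1) + \<i> * of_real (p \<i>)) / 2"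
  note prems = linear.prems
  interpret bounded_linear p by fact
  have "p (cis x) = p (cos x *\<^sub>R 1 + sin x *\<^sub>R \<i>)" for x
    by (rule arg_cong[where f = p]) (simp add: complex_eq_iff)
  then have "p (cis x) = cos x * p 1 + sin x * p \<i>" for x
    by (simp add: add scaleR)
  then have eq: "of_real (p (cis x)) * f x = \<alpha> * (cis (of_int 1 * x) * f x) + \<beta> * (cis (of_int (-1) * x) * f x)" for x
    by (simp add: \<alpha>_def \<beta>_def complex_eq_iff field_simps)
  have "integrable \<mu> (\<lambda>x. f x * cis (of_int k * x))" for k
    by (rule integrable_unimodular[OF _ prems(1)]) auto
  then have int: "integrable \<mu> (\<lambda>x. c * (cis (of_int k * x) * f x))" for c k
    by (simp add: mult.commute)
  show ?case
    unfolding eq using int prems(2)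
    by (simp only: coeff1_add coeff1_cmult coeff1_mult_cis Bochner_Integration.integrable_add) simp
next
  case (const c)
  then show ?case by (simp add: coeff1_cmult)
next
  case (add p q)
  then show ?case by (simp add: distrib_right coeff1_add)
next
  case (mult p q)
  then show ?case by (simp add: mult.assoc)
qed

text \<open>By Stone-Weierstrass real polynomials approximate \<open>h\<close> uniformly on the
  circle, and an error e in the multiplier costs at most e times the L^1 norm of
  \<open>f\<close>.\<close>

lemma integral_zero_mult_continuous:
  fixes h :: "complex \<Rightarrow> real"
  assumes f: "integrable \<mu> f" "\<And>m. coeff1 f m = 0" and h: "continuous_on UNIV h"
  shows "(\<integral>x. of_real (h (cis x)) * f x \<partial>\<mu>) = 0"
proof -
  note [measurable] = borel_measurable_integrable[OF f(1)] borel_measurable_continuous_onI[OF h]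
  have "cmod (\<integral>x. of_real (h (cis x)) * f x \<partial>\<mu>) \<le> e * (1 + (\<integral>x. cmod (f x) \<partial>\<mu>))" if "e > 0" for e
  proof -
    obtain p where p: "real_polynomial_function p" "\<And>w. w \<in> sphere 0 1 \<Longrightarrow> \<bar>h w - p w\<bar> < e"
      using Stone_Weierstrass_real_polynomial_function[of "sphere 0 1" h e] \<open>e > 0\<close>
        continuous_on_subset[OF h] by auto
    note pf = coeff1_zero_mult_polynomial[OF p(1) f]
    have p0: "(\<integral>x. of_real (p (cis x)) * f x \<partial>\<mu>) = 0"
      using pf[THEN conjunct2, rule_format, of 0] by (simp add: coeff1_def)
    have bd: "cmod (of_real (h (cis x) - p (cis x)) * f x) \<le> e * cmod (f x)" for x
      using p(2)[of "cis x"] by (auto simp: norm_mult simp flip: of_real_diff intro!: mult_right_mono)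
    have [measurable]: "p \<in> borel_measurable borel"
      using p(1) by (intro borel_measurable_continuous_onI continuous_on_polymonial_function)
         (simp add: real_polynomial_function_eq)
    have int: "integrable \<mu> (\<lambda>x. of_real (h (cis x) - p (cis x)) * f x)"
      by (rule Bochner_Integration.integrable_bound[where f = "\<lambda>x. e * cmod (f x)"]) (use f bd \<open>e > 0\<close> in auto)
    have "(\<integral>x. of_real (h (cis x)) * f x \<partial>\<mu>) = (\<integral>x. of_real (h (cis x) - p (cis x)) * f x + of_real (p (cis x)) * f x \<partial>\<mu>)"
      by (simp add: algebra_simps)
    also have "\<dots> = (\<integral>x. of_real (h (cis x) - p (cis x)) * f x \<partial>\<mu>)"
      using int pf p0 by (subst Bochner_Integration.integral_add) auto
    also have "cmod \<dots> \<le> (\<integral>x. e * cmod (f x) \<partial>\<mu>)"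
      using bd f int by (intro order_trans[OF integral_norm_bound] integral_mono) auto
    also have "\<dots> \<le> e * (1 + (\<integral>x. cmod (f x) \<partial>\<mu>))"
      using \<open>e > 0\<close> by (simp add: algebra_simps)
    finally show ?thesis .
  qed
  then have "cmod (\<integral>x. of_real (h (cis x)) * f x \<partial>\<mu>) \<le> 0 + e" if "e > 0" for e
  proof -
    \<comment> \<open>The added 1 keeps the divisor positive even when \<open>f\<close> vanishes
      a.e.\<close>
    let ?I = "1 + (\<integral>x. cmod (f x) \<partial>\<mu>)"
    have "?I > 0" by (intro add_pos_nonneg) auto
    with \<open>\<And>e. e > 0 \<Longrightarrow> _\<close>[of "e / ?I"] that show ?thesis by simp
  qed
  then have "cmod (\<integral>x. of_real (h (cis x)) * f x \<partial>\<mu>) \<le> 0"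
    by (rule field_le_epsilon)
  then show ?thesis by simp
qed

text \<open>The indicator of a nonempty closed set is the pointwise limit of the continuous
  functions max(0, 1 - N dist(w, A)), all bounded by 1.\<close>

lemma integral_zero_indicator_closed:
  assumes f: "integrable \<mu> f" "\<And>m. coeff1 f m = 0" and A: "closed A"
  shows "(\<integral>x. indicator A (cis x) * f x \<partial>\<mu>) = 0"
\<comment> \<open>\<open>infdist\<close> to the empty set is 0 by convention, which would make every
  \<open>h N\<close> below constantly 1.\<close>
proof (cases "A = {}")
  case False
  note [measurable] = borel_measurable_integrable[OF f(1)] borel_closed[OF A]
  define h where "h N w = max 0 (1 - real N * infdist w A)" for N w
  have h: "continuous_on UNIV (h N)" for N
    unfolding h_def by (intro continuous_intros)
  note [measurable] = borel_measurable_continuous_onI[OF h]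
  have lim: "(\<lambda>N. h N w) \<longlonglongrightarrow> indicator A w" for w
  proof (cases "w \<in> A")
    case True
    then show ?thesis by (simp add: h_def)
  next
    case notin: False
    have pos: "infdist w A > 0" by (rule infdist_pos_not_in_closed) fact+
    obtain N0 where "1 / infdist w A < real N0" using reals_Archimedean2 by blast
    have "h N w = 0" if "N \<ge> N0" for N
    proof -
      have "1 / infdist w A < real N" using \<open>_ < real N0\<close> that by simp
      then show ?thesis using pos by (simp add: h_def field_simps)
    qed
    then show ?thesis using notin
      by (auto intro!: tendsto_eventually eventually_sequentiallyI[of N0])
  qed
  have "(\<lambda>N. \<integral>x. of_real (h N (cis x)) * f x \<partial>\<mu>) \<longlonglongrightarrow> (\<integral>x. of_real (indicator A (cis x)) * f x \<partial>\<mu>)"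
  proof (rule integral_dominated_convergence[where w = "\<lambda>x. cmod (f x)"])
    show "AE x in \<mu>. (\<lambda>N. of_real (h N (cis x)) * f x) \<longlonglongrightarrow> of_real (indicator A (cis x)) * f x"
      using lim by (auto intro!: tendsto_intros)
    show "AE x in \<mu>. norm (of_real (h N (cis x)) * f x) \<le> cmod (f x)" for N
      by (auto simp: norm_mult h_def infdist_nonneg intro!: mult_left_le_one_le)
  qed (use f in auto)
  moreover have "complex_of_real (indicator A w) = indicator A w" for w
    by (simp split: split_indicator)
  ultimately show ?thesis
    using integral_zero_mult_continuous[OF f h] by (simp add: LIMSEQ_const_iff)
qed simp

text \<open>Closed sets generate the Borel sets and are stable under intersection, so a Dynkin
  argument applies.\<close>

lemma integral_zero_indicator_borel:
  assumes f: "integrable \<mu> f" "\<And>m. coeff1 f m = 0" and A: "A \<in> sets borel"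
  shows "(\<integral>x. indicator A (cis x) * f x \<partial>\<mu>) = 0"
proof -
  note [measurable] = borel_measurable_integrable[OF f(1)]
  have A': "A \<in> sigma_sets UNIV (Collect closed)"
    using A by (simp add: borel_eq_closed)
  have sub: "B \<in> sets borel" if "B \<in> sigma_sets UNIV (Collect closed)" for B :: "complex set"
    using that by (simp add: borel_eq_closed)
  have int: "integrable \<mu> (\<lambda>x. indicator B (cis x) * f x)" if [measurable]: "B \<in> sets borel" for B
    by (rule Bochner_Integration.integrable_bound[OF f(1)]) (auto simp: norm_mult split: split_indicator)
  have "Int_stable (Collect closed :: complex set set)"
    by (auto simp: Int_stable_def)
  moreover have "Collect closed \<subseteq> (Pow UNIV :: complex set set)" by simp
  ultimately show ?thesis
    using A'
  proof (induction rule: sigma_sets_induct_disjoint)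
    case (basic A)
    then show ?case using integral_zero_indicator_closed[OF f] by simp
  next
    case (compl B)
    have "(\<integral>x. indicator (UNIV - B) (cis x) * f x \<partial>\<mu>) =
        (\<integral>x. f x - indicator B (cis x) * f x \<partial>\<mu>)"
      by (intro Bochner_Integration.integral_cong) (auto split: split_indicator)
    also have "\<dots> = 0"
      using compl f(2)[of 0] int[OF sub[OF compl(1)]] f(1)
      by (subst Bochner_Integration.integral_diff) (auto simp: coeff1_def)
    finally show ?case .
  next
    case (union B)
    have [measurable]: "B i \<in> sets borel" for i
      using union(2) by (intro sub) auto
    have s: "cis -` B i \<in> sets \<mu>" for i
      using measurable_sets[OF cis_measurable, of "B i"] by simp
    then have UN: "(\<Union>i. cis -` B i) \<in> sets \<mu>" by (intro sets.countable_UN) auto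
    have ind: "indicator C (cis x) * f x = indicator (cis -` C) x *\<^sub>R f x" for C x
      by (auto split: split_indicator)
    have "(LINT x:(\<Union>i. cis -` B i)|\<mu>. f x) = (\<Sum>i. (LINT x:(cis -` B i)|\<mu>. f x))"
    proof (rule lebesgue_integral_countable_add[OF s])
      show "cis -` B i \<inter> cis -` B j = {}" if "i \<noteq> j" for i j
        using union(1) that by (auto simp: disjoint_family_on_def)
      show "set_integrable \<mu> (\<Union>i. cis -` B i) f"
        unfolding set_integrable_def by (rule integrable_mult_indicator[OF UN f(1)])
    qed
    then show ?case
      using union(3) by (simp add: ind set_lebesgue_integral_def vimage_UN)
  qed auto
qed


text \<open>So far only preimages of Borel sets under \<open>cis\<close> have been tested. A Borel
  left inverse of \<open>cis\<close> on [0, 2 pi) presents every Borel set of angles as such a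
  preimage, up to the null endpoint 2 pi. Real and imaginary parts then have zero integral over
  every measurable set.\<close>

lemma coeff1_zero_imp_AE_zero:
  assumes f: "integrable \<mu> f" "\<And>m. coeff1 f m = 0"
  shows "AE x in \<mu>. f x = 0"
proof -
  note [measurable] = borel_measurable_integrable[OF f(1)]
  \<comment> \<open>Clamping to [-1, 1] makes \<open>arccos\<close> continuous on the whole line, so
    that \<open>\<theta>\<close> is Borel on the whole plane.\<close>
  define t where "t r = arccos (max (-1) (min 1 r))" for r
  define \<theta> where "\<theta> w = (if Im w \<ge> 0 then t (Re w) else 2 * pi - t (Re w))" for w
  have "continuous_on UNIV t"
    unfolding t_def by (rule continuous_on_compose2[OF continuous_on_arccos'])
      (auto intro!: continuous_intros)
  note [measurable] = borel_measurable_continuous_onI[OF this]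
  have [measurable]: "\<theta> \<in> borel_measurable borel"
    unfolding \<theta>_def by measurable
  have \<theta>: "\<theta> (cis x) = x" if "x \<in> {0..<2*pi}" for x
  proof (cases "x \<le> pi")
    case True
    then show ?thesis using that by (simp add: \<theta>_def t_def sin_ge_zero arccos_cos)
  next
    case False
    then have "sin x < 0" using that by (intro sin_lt_zero) auto
    moreover have "arccos (cos x) = 2 * pi - x"
      using False that arccos_cos[of "2 * pi - x"] by (simp add: cos_diff)
    ultimately show ?thesis by (simp add: \<theta>_def t_def)
  qed
  have AE: "AE x in \<mu>. x \<in> {0..<2*pi}"
  proof (rule AE_circle)
    have "AE x in lborel. x \<noteq> 2 * pi" by (rule AE_lborel_singleton)
    then show "AE x in lborel. x \<in> circ \<longrightarrow> x \<in> {0..<2*pi}"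
      by eventually_elim (auto simp: circ_def)
  qed
  have zero: "(\<integral>x. indicator A x *\<^sub>R f x \<partial>\<mu>) = 0" if "A \<in> sets \<mu>" for A
  proof -
    have A [measurable]: "A \<in> sets borel" using that by simp
    have B: "\<theta> -` A \<in> sets borel"
      using measurable_sets[of \<theta> borel borel A] by simp
    then have [measurable]: "\<theta> -` A \<in> sets borel" .
    have "(\<integral>x. indicator A x *\<^sub>R f x \<partial>\<mu>) = (\<integral>x. indicator (\<theta> -` A) (cis x) * f x \<partial>\<mu>)"
    proof (rule integral_cong_AE)
      show "AE x in \<mu>. indicator A x *\<^sub>R f x = indicator (\<theta> -` A) (cis x) * f x"
        using AE by eventually_elim (auto simp: \<theta> split: split_indicator)
    qed measurable
    also have "\<dots> = 0" by (rule integral_zero_indicator_borel[OF f B])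
    finally show ?thesis .
  qed
  have int: "integrable \<mu> (\<lambda>x. indicator A x *\<^sub>R f x)" if "A \<in> sets \<mu>" for A
    by (rule integrable_mult_indicator[OF that f(1)])
  have "AE x in \<mu>. Re (f x) = 0"
  proof (rule density_unique_real)
    show "(LINT x:A|\<mu>. Re (f x)) = (LINT x:A|\<mu>. 0)" if "A \<in> sets \<mu>" for A
      using integral_Re[OF int[OF that]] zero[OF that] by (simp add: set_lebesgue_integral_def)
  qed (use f in auto)
  moreover have "AE x in \<mu>. Im (f x) = 0"
  proof (rule density_unique_real)
    show "(LINT x:A|\<mu>. Im (f x)) = (LINT x:A|\<mu>. 0)" if "A \<in> sets \<mu>" for A
      using integral_Im[OF int[OF that]] zero[OF that] by (simp add: set_lebesgue_integral_def)
  qed (use f in auto)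
  ultimately show ?thesis by eventually_elim (simp add: complex_eq_iff)
qed

section \<open>Functions of one coordinate and slices of functions on the torus\<close>

lemma integrable_fst_circle:
  fixes u :: "real \<Rightarrow> 'a :: {banach, second_countable_topology}"
  assumes "integrable \<mu> u"
  shows "integrable \<mu>\<^sub>2 (\<lambda>p. u (fst p))"
  using integrable_distr[of fst \<mu>\<^sub>2 \<mu> u] assms by (simp add: circle.distr_pair_fst)

lemma sq_int_fst: "sq_int \<mu> u \<Longrightarrow> sq_int \<mu>\<^sub>2 (\<lambda>p. u (fst p))"
  using integrable_fst_circle[of "\<lambda>x. (cmod (u x))\<^sup>2"]
  by (auto simp: sq_int_def)

lemma sq_int_snd: "sq_int \<mu> u \<Longrightarrow> sq_int \<mu>\<^sub>2 (\<lambda>p. u (snd p))"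
  using sq_int_swap[OF sq_int_fst] by simp

lemma coeff2_product:
  assumes "sq_int \<mu> u" "sq_int \<mu> v"
  shows "coeff2 (\<lambda>p. u (fst p) * v (snd p)) m n = coeff1 u m * coeff1 v n"
proof -
  have "integrable \<mu>\<^sub>2 (\<lambda>p. u (fst p) * v (snd p))"
    by (intro sq_int_mult_integrable sq_int_fst sq_int_snd assms)
  from torus.integral_fst'[OF integrable_coeff2[OF this, of m n]]
  have "coeff2 (\<lambda>p. u (fst p) * v (snd p)) m n =
      (\<integral>x. \<integral>y. (u x * cis (- (of_int m * x))) * (v y * cis (- (of_int n * y))) \<partial>\<mu> \<partial>\<mu>)"
    by (simp add: coeff2_def mult_ac)
  then show ?thesis by (simp add: coeff1_def)
qed

lemma coeff2_fst:
  assumes "sq_int \<mu> u"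
  shows "coeff2 (\<lambda>p. u (fst p)) m n = (if n = 0 then coeff1 u m else 0)"
  using coeff2_product[OF assms, of "\<lambda>x. 1" m n] by (simp add: sq_int_def coeff1_one)

lemma H2_1_fst_iff:
  assumes "sq_int \<mu> u"
  shows "(\<lambda>p. u (fst p)) \<in> H2_2 \<longleftrightarrow> u \<in> H2_1"
  by (auto simp: H2_1_iff H2_2_iff assms sq_int_fst coeff2_fst)

text \<open>The n-th coefficient in y of the slice at x is an integrable function \<open>K\<close>
  of x whose own coefficients are the numbers \<open>coeff2 f m n\<close>. By uniqueness
  \<open>K\<close> is zero a.e., so any square-integrable weight in x may be inserted.\<close>

lemma integral_zero_slice:
  assumes f: "sq_int \<mu>\<^sub>2 f" "\<And>m. coeff2 f m n = 0" and q: "sq_int \<mu> q"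
  shows "(\<integral>p. f p * q (fst p) * cis (- (of_int n * snd p)) \<partial>\<mu>\<^sub>2) = 0"
proof -
  note [measurable] = sq_int_measurable[OF f(1)] sq_int_measurable[OF q]
  define K where "K x = (\<integral>y. f (x, y) * cis (- (of_int n * y)) \<partial>\<mu>)" for x
  have "integrable \<mu>\<^sub>2 (\<lambda>p. f p * cis (- (of_int n * snd p)))"
    by (intro integrable_unimodular torus.sq_int_integrable f) auto
  note intK = torus.integrable_fst'[OF this]
  have "coeff1 K m = coeff2 f m n" for m
  proof -
    have "integrable \<mu>\<^sub>2 (\<lambda>p. f p * cis (- (of_int m * fst p)) * cis (- (of_int n * snd p)))"
      by (intro integrable_coeff2 torus.sq_int_integrable f)
    from torus.integral_fst'[OF this]
    have "coeff2 f m n = (\<integral>x. \<integral>y. cis (- (of_int m * x)) * (f (x, y) * cis (- (of_int n * y))) \<partial>\<mu> \<partial>\<mu>)"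
      by (simp add: coeff2_def mult_ac)
    then show ?thesis
      by (simp add: coeff1_def K_def mult.commute)
  qed
  moreover have "integrable \<mu> K"
    using intK by (simp add: K_def[abs_def])
  ultimately have "AE x in \<mu>. K x = 0"
    using f(2) by (intro coeff1_zero_imp_AE_zero) auto
  then have ae: "AE x in \<mu>. q x * K x = 0" by eventually_elim simp
  have "integrable \<mu>\<^sub>2 (\<lambda>p. f p * q (fst p) * cis (- (of_int n * snd p)))"
    by (intro integrable_unimodular sq_int_mult_integrable f sq_int_fst q) auto
  from torus.integral_fst'[OF this]
  have "(\<integral>p. f p * q (fst p) * cis (- (of_int n * snd p)) \<partial>\<mu>\<^sub>2) = (\<integral>x. q x * K x \<partial>\<mu>)"
    by (simp add: K_def mult.assoc mult.left_commute[of _ "q _"])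
  also have "\<dots> = 0"
    by (rule integral_eq_zero_AE[OF ae])
  finally show ?thesis .
qed

subsection \<open>Difference quotients and Blaschke products\<close>

lemma Hinf_continuous:
  assumes "f holomorphic_on ball 0 1" "continuous_on (cball 0 1) f"
  shows "Hinf f (\<lambda>x. f (cis x))"
proof -
  have "compact (f ` cball 0 1)"
    using assms(2) by (intro compact_continuous_image) auto
  then have "bounded (f ` ball 0 1)"
    by (rule bounded_subset[OF compact_imp_bounded]) auto
  moreover have "continuous_on UNIV (\<lambda>x. f (cis x))"
    by (rule continuous_on_compose2[OF assms(2)]) (auto intro: continuous_intros)
  then have "(\<lambda>x. f (cis x)) \<in> borel_measurable lborel"
    by (simp add: borel_measurable_continuous_onI)
  moreover have "((\<lambda>r. f (of_real r * cis x)) \<longlongrightarrow> f (cis x)) (at_left 1)" for x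
  proof (rule continuous_on_tendsto_compose[OF assms(2)])
    have "((\<lambda>r. of_real r * cis x) \<longlongrightarrow> of_real 1 * cis x) (at_left (1::real))"
      by (intro tendsto_intros)
    then show "((\<lambda>r. of_real r * cis x) \<longlongrightarrow> cis x) (at_left (1::real))" by simp
    have "\<forall>\<^sub>F r in at_left (1::real). r \<in> {0<..<1}"
      by (rule eventually_at_leftI[of 0]) auto
    then show "\<forall>\<^sub>F r in at_left 1. of_real r * cis x \<in> cball 0 1"
      by eventually_elim (simp add: norm_mult)
  qed simp
  ultimately show ?thesis
    using assms(1) by (simp add: Hinf_def)
qed

text \<open>The singularity is removable. The quotient is bounded near z by compactness, and away
  from z because the numerator is at most 2C and the denominator at least \<open>d\<close>.\<close>

lemma Hinf_difference_quotient:
  assumes G: "Hinf g G" and z: "cmod z < 1"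
  shows "Hinf (\<lambda>w. if w = z then deriv g z else (g w - g z) / (w - z)) (\<lambda>x. (G x - g z) / (cis x - z))"
    (is "Hinf ?q _")
proof -
  obtain C where C: "C \<ge> 0" "\<And>w. cmod w < 1 \<Longrightarrow> cmod (g w) \<le> C"
    using Hinf_bound[OF G] by metis
  have hol: "?q holomorphic_on ball 0 1"
    using G z by (intro pole_lemma) (auto simp: Hinf_def interior_open)
  \<comment> \<open>Half the distance from z to the circle, so the closed disc of radius
    \<open>d\<close> around z stays inside the open unit disc.\<close>
  define d where "d = (1 - cmod z) / 2"
  have d: "d > 0" using z by (simp add: d_def)
  have sub: "cball z d \<subseteq> ball 0 1"
  proof
    fix w assume "w \<in> cball z d"
    then have "cmod (w - z) \<le> d" by (simp add: dist_norm norm_minus_commute)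
    moreover have "cmod w \<le> cmod (w - z) + cmod z" using norm_triangle_ineq[of "w - z" z] by simp
    ultimately show "w \<in> ball 0 1" using z by (simp add: d_def field_simps)
  qed
  have "compact (?q ` cball z d)"
    by (intro compact_continuous_image continuous_on_subset[OF holomorphic_on_imp_continuous_on[OF hol] sub]) auto
  then obtain B where "\<forall>v \<in> ?q ` cball z d. cmod v \<le> B"
    using compact_imp_bounded[of "?q ` cball z d"] unfolding bounded_iff by auto
  then have B: "cmod (?q w) \<le> B" if "w \<in> cball z d" for w
    using that by (rule bspec[OF _ imageI])
  have "cmod (?q w) \<le> max B ((C + C) / d)" if w: "w \<in> ball 0 1" for w
  proof (cases "w \<in> cball z d")
    case True
    then show ?thesis using B[OF True] by (simp add: le_max_iff_disj)
  next
    case False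
    then have far: "cmod (w - z) > d" by (simp add: dist_norm norm_minus_commute)
    then have "w \<noteq> z" using d by auto
    have "cmod (?q w) = cmod (g w - g z) / cmod (w - z)"
      using \<open>w \<noteq> z\<close> by (simp add: norm_divide)
    also have "\<dots> \<le> (C + C) / d"
    proof (rule frac_le)
      show "cmod (g w - g z) \<le> C + C"
        using w z by (intro order_trans[OF norm_triangle_ineq4] add_mono C) auto
    qed (use C d far in auto)
    finally show ?thesis by simp
  qed
  then have "bounded (?q ` ball 0 1)"
    unfolding bounded_iff by (intro exI[of _ "max B ((C + C) / d)"] ballI) (erule imageE, simp only:)
  moreover have [measurable]: "G \<in> borel_measurable borel"
    using G by (simp add: Hinf_def)
  have "(\<lambda>x. (G x - g z) / (cis x - z)) \<in> borel_measurable lborel" by measurable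
  moreover have "AE x in lborel. x \<in> circ \<longrightarrow> ((\<lambda>r. ?q (of_real r * cis x)) \<longlongrightarrow> (G x - g z) / (cis x - z)) (at_left 1)"
  proof -
    have "AE x in lborel. x \<in> circ \<longrightarrow> ((\<lambda>r. g (of_real r * cis x)) \<longlongrightarrow> G x) (at_left 1)"
      using G by (simp add: Hinf_def)
    then show ?thesis
    proof eventually_elim
      case (elim x)
      show ?case
      proof
        assume "x \<in> circ"
        have "cis x \<noteq> z" using z by auto
        have "((\<lambda>r. of_real r * cis x) \<longlongrightarrow> of_real 1 * cis x) (at_left (1::real))"
          by (intro tendsto_intros)
        then have "((\<lambda>r. (g (of_real r * cis x) - g z) / (of_real r * cis x - z)) \<longlongrightarrow> (G x - g z) / (cis x - z)) (at_left 1)"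
          using elim \<open>x \<in> circ\<close> \<open>cis x \<noteq> z\<close> by (intro tendsto_intros) auto
        \<comment> \<open>Beyond radius |z| the radial path avoids z, so the \<open>if\<close> in
          the quotient takes its second branch.\<close>
        moreover have "\<forall>\<^sub>F r in at_left (1::real). r \<in> {cmod z<..<1}"
          by (rule eventually_at_leftI[of "cmod z"]) (use z in auto)
        then have "\<forall>\<^sub>F r in at_left 1. (g (of_real r * cis x) - g z) / (of_real r * cis x - z) = ?q (of_real r * cis x)"
        proof eventually_elim
          case (elim r)
          then have "\<bar>r\<bar> > cmod z" by auto
          then have "cmod (of_real r * cis x) \<noteq> cmod z"
            by (simp add: norm_mult)
          then have "of_real r * cis x \<noteq> z" by blast
          then show ?case by simp
        qed
        ultimately show "((\<lambda>r. ?q (of_real r * cis x)) \<longlongrightarrow> (G x - g z) / (cis x - z)) (at_left 1)"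
          by (rule Lim_transform_eventually)
      qed
    qed
  qed
  ultimately show ?thesis using hol by (simp add: Hinf_def)
qed

lemma disc_denominator_nonzero:
  assumes "cmod z < 1" "cmod w \<le> 1"
  shows "1 - cnj z * w \<noteq> 0"
proof
  assume "1 - cnj z * w = 0"
  then have "cnj z * w = 1" by simp
  then have "cmod (cnj z * w) = 1" by (simp only: norm_one)
  moreover have "cmod (cnj z * w) \<le> cmod z"
    using assms(2) by (simp add: norm_mult mult_left_le)
  ultimately show False using assms(1) by simp
qed

lemma cis_neq_disc: "cmod z < 1 \<Longrightarrow> cis x \<noteq> z"
  by auto

lemma Hinf_cauchy_kernel:
  assumes "cmod z < 1"
  shows "Hinf (\<lambda>w. 1 / (1 - cnj z * w)) (\<lambda>x. 1 / (1 - cnj z * cis x))"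
proof (rule Hinf_continuous)
  have *: "1 - cnj z * w \<noteq> 0" if "cmod w \<le> 1" for w
    using disc_denominator_nonzero[OF assms that] .
  show "(\<lambda>w. 1 / (1 - cnj z * w)) holomorphic_on ball 0 1"
    using * by (intro holomorphic_intros) auto
  show "continuous_on (cball 0 1) (\<lambda>w. 1 / (1 - cnj z * w))"
    using * by (intro continuous_intros) auto
qed

text \<open>Since conjugation inverts points of the circle, 1 / (w - z) is the conjugate of an
  analytic function vanishing at the origin. This is the source of the orthogonality of
  \<open>xi\<close> to b H^2 and of the mean zero of the kernel.\<close>

lemma inverse_cis_diff:
  assumes "cmod z < 1"
  shows "1 / (cis x - z) = cnj (cis x * (1 / (1 - cnj z * cis x)))"
proof -
  have "cis x - z \<noteq> 0" "1 - z * cis (- x) \<noteq> 0"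
    using cis_neq_disc[OF assms] disc_denominator_nonzero[of "cnj z" "cis (- x)"] assms by auto
  moreover have "cis (- x) * cis x = 1" by (simp add: cis_mult)
  ultimately show ?thesis
    by (simp add: cis_cnj field_simps)
qed

lemma Hinf_blaschke:
  assumes "simple_blaschke b zs n"
  shows "Hinf b (\<lambda>x. b (cis x))"
proof (rule Hinf_continuous)
  obtain c where b: "b = blaschke c zs n" and zs: "\<And>k. k < n \<Longrightarrow> cmod (zs k) < 1"
    using assms by (auto simp: simple_blaschke_def)
  have *: "1 - cnj (zs k) * w \<noteq> 0" if "k < n" "cmod w \<le> 1" for k w
    using disc_denominator_nonzero[OF zs[OF that(1)] that(2)] .
  show "b holomorphic_on ball 0 1"
    unfolding b blaschke_def[abs_def] using * by (intro holomorphic_intros) auto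
  show "continuous_on (cball 0 1) b"
    unfolding b blaschke_def[abs_def] using * by (intro continuous_intros) auto
qed

lemma blaschke_zero: "simple_blaschke b zs n \<Longrightarrow> k < n \<Longrightarrow> b (zs k) = 0"
  by (auto simp: simple_blaschke_def blaschke_def)

lemma simple_blaschke_disc: "simple_blaschke b zs n \<Longrightarrow> k < n \<Longrightarrow> cmod (zs k) < 1"
  by (auto simp: simple_blaschke_def)

lemma cis_factor:
  assumes "cmod z < 1"
  shows "cnj ((cis x - z) / (1 - cnj z * cis x)) = (1 - cnj z * cis x) / (cis x - z)"
proof -
  have "cis x - z \<noteq> 0" "1 - z * cis (- x) \<noteq> 0"
    using cis_neq_disc[OF assms] disc_denominator_nonzero[of "cnj z" "cis (- x)"] assms by auto
  moreover have "cis (- x) * cis x = 1" by (simp add: cis_mult)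
  ultimately show ?thesis
    by (simp add: cis_cnj field_simps)
qed

lemma cnj_blaschke_cis:
  assumes "\<And>k. k < n \<Longrightarrow> cmod (zs k) < 1"
  shows "cnj (blaschke c zs n (cis x)) = cnj c * (\<Prod>k<n. (1 - cnj (zs k) * cis x) / (cis x - zs k))"
  unfolding blaschke_def complex_cnj_mult cnj_prod
  by (intro arg_cong2[where f = "(*)"] prod.cong refl cis_factor assms) auto

lemma blaschke_unimodular:
  assumes "simple_blaschke b zs n"
  shows "b (cis x) * cnj (b (cis x)) = 1"
proof -
  obtain c where c: "cmod c = 1" and b: "b = blaschke c zs n" and zs: "\<And>k. k < n \<Longrightarrow> cmod (zs k) < 1"
    using assms by (auto simp: simple_blaschke_def)
  have "cmod c ^ 2 = 1" using c by simp
  then have "c * cnj c = 1" by (metis complex_norm_square of_real_1)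
  moreover have "(cis x - zs k) / (1 - cnj (zs k) * cis x) * ((1 - cnj (zs k) * cis x) / (cis x - zs k)) = 1" if "k < n" for k
    using cis_neq_disc[OF zs[OF that], of x] disc_denominator_nonzero[OF zs[OF that], of "cis x"] by simp
  then have "(\<Prod>k<n. (cis x - zs k) / (1 - cnj (zs k) * cis x)) * (\<Prod>k<n. (1 - cnj (zs k) * cis x) / (cis x - zs k)) = 1"
    (is "?P * ?Q = 1")
    unfolding prod.distrib[symmetric] by (intro prod.neutral) auto
  ultimately have "(c * cnj c) * (?P * ?Q) = 1" by simp
  then have "(c * ?P) * (cnj c * ?Q) = 1" by (simp only: mult_ac)
  moreover have "b (cis x) = c * ?P" by (simp add: b blaschke_def)
  moreover have "cnj (b (cis x)) = cnj c * ?Q" unfolding b by (rule cnj_blaschke_cis[OF zs])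
  ultimately show ?thesis by (simp only:)
qed

lemma norm_blaschke_cis:
  assumes "simple_blaschke b zs n"
  shows "cmod (b (cis x)) = 1"
proof -
  have "complex_of_real ((cmod (b (cis x)))\<^sup>2) = 1"
    using blaschke_unimodular[OF assms] by (simp only: complex_norm_square)
  then have "(cmod (b (cis x)))\<^sup>2 = 1" using of_real_eq_1_iff by blast
  then show ?thesis by (simp add: power2_eq_1_iff) (smt (verit) norm_ge_zero)
qed

text \<open>\<open>xi b (zs k)\<close> is the difference quotient of b at a zero, hence bounded
  analytic.\<close>

lemma Hinf_xi:
  assumes "simple_blaschke b zs n" "k < n"
  obtains g where "Hinf g (xi b (zs k))"
  using Hinf_difference_quotient[OF Hinf_blaschke[OF assms(1)] simple_blaschke_disc[OF assms]]
  by (simp add: blaschke_zero[OF assms] xi_def[abs_def])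

lemma xi_cnj_blaschke:
  assumes "simple_blaschke b zs n"
  shows "xi b z x * cnj (b (cis x)) = 1 / (cis x - z)"
  using blaschke_unimodular[OF assms, of x] by (simp add: xi_def)

text \<open>On the circle, cnj b is the rational function 1 / b, whose poles are simple.\<close>

lemma cnj_blaschke_partial_fractions:
  assumes "simple_blaschke b zs n"
  shows "\<exists>C r. \<forall>x. cnj (b (cis x)) = C + (\<Sum>i<n. r i / (cis x - zs i))"
proof -
  obtain c where b: "b = blaschke c zs n" and zs: "\<And>k. k < n \<Longrightarrow> cmod (zs k) < 1" and inj: "inj_on zs {..<n}"
    using assms by (auto simp: simple_blaschke_def)
  have "\<exists>C r. \<forall>x. (\<Prod>k<m. (1 - cnj (zs k) * cis x) / (cis x - zs k)) = C + (\<Sum>i<m. r i / (cis x - zs i))"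
    if "m \<le> n" for m
    using that
  proof (induction m)
    case 0
    show ?case by (intro exI[of _ 1]) simp
  next
    case (Suc m)
    then obtain C r where IH: "\<And>x. (\<Prod>k<m. (1 - cnj (zs k) * cis x) / (cis x - zs k)) = C + (\<Sum>i<m. r i / (cis x - zs i))"
      by auto
    let ?z = "zs m"
    \<comment> \<open>With these constants the new factor is \<open>\<alpha>\<close> +
      \<open>\<beta>\<close> / (w - z), where z = \<open>zs m\<close>.\<close>
    define \<alpha> \<beta> where "\<alpha> = - cnj ?z" and "\<beta> = 1 - cnj ?z * ?z"
    \<comment> \<open>Residues of the enlarged product: at the new pole, \<open>\<beta>\<close>
      times the value there of the old product; at an old pole, the old residue times the value
      there of the new factor.\<close>
    define r' where "r' i = (if i = m then \<beta> * C + (\<Sum>j<m. \<beta> * r j / (?z - zs j))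
        else \<alpha> * r i + \<beta> * r i / (zs i - ?z))" for i
    have "(\<Prod>k<Suc m. (1 - cnj (zs k) * cis x) / (cis x - zs k)) = \<alpha> * C + (\<Sum>i<Suc m. r' i / (cis x - zs i))" for x
    proof -
      have nz: "cis x - ?z \<noteq> 0" using zs[of m] Suc by (auto simp: cis_neq_disc)
      then have fac: "(1 - cnj ?z * cis x) / (cis x - ?z) = \<alpha> + \<beta> / (cis x - ?z)"
        by (simp add: \<alpha>_def \<beta>_def field_simps)
      have summand: "(r i / (cis x - zs i)) * (\<alpha> + \<beta> / (cis x - ?z)) =
        r' i / (cis x - zs i) + (\<beta> * r i / (?z - zs i)) / (cis x - ?z)" if "i < m" for i
      proof -
        \<comment> \<open>Simplicity of the zeros enters here: 1 / ((w - z_i)(w - z_m)) splits into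
          simple fractions only for distinct poles.\<close>
        have "zs i \<noteq> ?z" using inj_onD[OF inj, of i m] that Suc by auto
        then have "zs i - ?z \<noteq> 0" by auto
        moreover have "cis x - zs i \<noteq> 0" using zs[of i] that Suc by (auto simp: cis_neq_disc)
        ultimately have key: "inverse (cis x - zs i) * inverse (cis x - ?z) =
            inverse (zs i - ?z) * (inverse (cis x - zs i) - inverse (cis x - ?z))"
          using nz by (simp add: field_simps)
        have "r i * u * (\<alpha> + \<beta> * v) = (\<alpha> * r i + \<beta> * r i * s) * u + \<beta> * r i * (- s) * v"
          if "u * v = s * (u - v)" for u v s :: complex
          using that by algebra
        from this[OF key] show ?thesis
          using that by (simp add: r'_def divide_inverse flip: inverse_minus_eq)
      qed
      have "(\<Prod>k<Suc m. (1 - cnj (zs k) * cis x) / (cis x - zs k)) =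
        C * (\<alpha> + \<beta> / (cis x - ?z)) + (\<Sum>i<m. (r i / (cis x - zs i)) * (\<alpha> + \<beta> / (cis x - ?z)))"
        by (simp add: IH fac distrib_right sum_distrib_right)
      also have "(\<Sum>i<m. (r i / (cis x - zs i)) * (\<alpha> + \<beta> / (cis x - ?z))) =
        (\<Sum>i<m. r' i / (cis x - zs i) + (\<beta> * r i / (?z - zs i)) / (cis x - ?z))"
        by (intro sum.cong refl summand) auto
      also have "\<dots> = (\<Sum>i<m. r' i / (cis x - zs i)) + (\<Sum>i<m. \<beta> * r i / (?z - zs i)) / (cis x - ?z)"
        by (simp only: sum.distrib sum_divide_distrib)
      also have "C * (\<alpha> + \<beta> / (cis x - ?z)) + \<dots> = \<alpha> * C + (\<Sum>i<Suc m. r' i / (cis x - zs i))"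
        by (simp add: r'_def add_divide_distrib algebra_simps)
      finally show ?thesis .
    qed
    then show ?case by blast
  qed
  from this[of n] obtain C r where
    "\<And>x. (\<Prod>k<n. (1 - cnj (zs k) * cis x) / (cis x - zs k)) = C + (\<Sum>i<n. r i / (cis x - zs i))"
    by auto
  then have "cnj (b (cis x)) = cnj c * C + (\<Sum>i<n. (cnj c * r i) / (cis x - zs i))" for x
    using cnj_blaschke_cis[of n zs c x, OF zs] unfolding b by (simp add: distrib_left sum_distrib_left)
  then show ?thesis by (intro exI allI)
qed

subsection \<open>Division by a linear factor\<close>

lemma inverse_cis_diff_bound:
  assumes "cmod z < 1"
  shows "cmod (1 / (cis x - z)) \<le> 1 / (1 - cmod z)"
proof -
  have "1 - cmod z \<le> cmod (cis x - z)"
    using norm_triangle_ineq2[of "cis x" z] by simp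
  then show ?thesis
    using assms by (simp add: norm_divide frac_le)
qed

text \<open>Evaluation at z in the disc, by the Cauchy integral formula, of a function in the Hardy space.\<close>

definition cauchy_eval :: "complex \<Rightarrow> (real \<Rightarrow> complex) \<Rightarrow> complex" where
  "cauchy_eval z u = (\<integral>x. u x * (cis x / (cis x - z)) \<partial>\<mu>)"

lemma integral_zero_slice_snd:
  assumes f: "sq_int \<mu>\<^sub>2 f" "\<And>n. coeff2 f m n = 0" and q: "sq_int \<mu> q"
  shows "(\<integral>p. f p * q (snd p) * cis (- (of_int m * fst p)) \<partial>\<mu>\<^sub>2) = 0"
proof -
  note [measurable] = sq_int_measurable[OF f(1)] sq_int_measurable[OF q]
  have "(\<integral>p. f p * q (snd p) * cis (- (of_int m * fst p)) \<partial>\<mu>\<^sub>2) =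
    (\<integral>p. f (prod.swap p) * q (fst p) * cis (- (of_int m * snd p)) \<partial>\<mu>\<^sub>2)"
    by (subst integral_swap[symmetric]) auto
  also have "\<dots> = 0"
    by (rule integral_zero_slice[OF sq_int_swap[OF f(1)] _ q])
       (use f in \<open>simp add: coeff2_swap sq_int_measurable\<close>)
  finally show ?thesis .
qed

text \<open>The Cauchy kernel is bounded by 1 / (1 - |z|) on the circle, so on almost every slice
  the evaluation is at most that multiple of the L^2 norm of the slice; Fubini then integrates the
  square.\<close>

lemma sq_int_cauchy_eval:
  assumes f: "sq_int \<mu>\<^sub>2 f" and z: "cmod z < 1"
  shows "sq_int \<mu> (\<lambda>x. cauchy_eval z (\<lambda>y. f (x, y)))"
proof -
  note [measurable] = sq_int_measurable[OF f]
  define B where "B = 1 / (1 - cmod z)"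
  have meas [measurable]: "(\<lambda>x. cauchy_eval z (\<lambda>y. f (x, y))) \<in> borel_measurable \<mu>"
    unfolding cauchy_eval_def by measurable
  have int2: "integrable \<mu>\<^sub>2 (\<lambda>p. (cmod (f p))\<^sup>2)"
    using f by (simp add: sq_int_def)
  have "integrable \<mu> (\<lambda>x. B\<^sup>2 * (\<integral>y. (cmod (f (x, y)))\<^sup>2 \<partial>\<mu>))"
    using torus.integrable_fst'[OF int2] by simp
  then have "integrable \<mu> (\<lambda>x. (cmod (cauchy_eval z (\<lambda>y. f (x, y))))\<^sup>2)"
  proof (rule Bochner_Integration.integrable_bound)
    show "AE x in \<mu>. norm ((cmod (cauchy_eval z (\<lambda>y. f (x, y))))\<^sup>2) \<le> norm (B\<^sup>2 * (\<integral>y. (cmod (f (x, y)))\<^sup>2 \<partial>\<mu>))"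
      using torus.AE_integrable_fst'[OF int2]
    proof eventually_elim
      case (elim x)
      then have sq: "sq_int \<mu> (\<lambda>y. f (x, y))"
        unfolding sq_int_def by simp
      note int = circle.sq_int_integrable[OF sq]
      have bound: "cmod (f (x, y) * (cis y / (cis y - z))) \<le> B * cmod (f (x, y))" for y
      proof -
        have "cmod (f (x, y) * (cis y / (cis y - z))) = cmod (1 / (cis y - z)) * cmod (f (x, y))"
          by (simp add: norm_mult norm_divide)
        also have "\<dots> \<le> B * cmod (f (x, y))"
          unfolding B_def by (intro mult_right_mono inverse_cis_diff_bound z) auto
        finally show ?thesis .
      qed
      have "integrable \<mu> (\<lambda>y. f (x, y) * (cis y / (cis y - z)))"
        by (rule Bochner_Integration.integrable_bound[where f = "\<lambda>y. B * cmod (f (x, y))"])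
           (use int bound z in \<open>auto simp: B_def\<close>)
      then have "cmod (cauchy_eval z (\<lambda>y. f (x, y))) \<le> (\<integral>y. B * cmod (f (x, y)) \<partial>\<mu>)"
        unfolding cauchy_eval_def using bound int
        by (intro order_trans[OF integral_norm_bound] integral_mono) auto
      then have "cmod (cauchy_eval z (\<lambda>y. f (x, y))) \<le> B * (\<integral>y. cmod (f (x, y)) \<partial>\<mu>)"
        by simp
      then have "(cmod (cauchy_eval z (\<lambda>y. f (x, y))))\<^sup>2 \<le> (B * (\<integral>y. cmod (f (x, y)) \<partial>\<mu>))\<^sup>2"
        by (intro power_mono) auto
      also have "\<dots> \<le> B\<^sup>2 * (\<integral>y. (cmod (f (x, y)))\<^sup>2 \<partial>\<mu>)"
      proof -
        \<comment> \<open>Nonnegativity of the variance is the Cauchy-Schwarz inequality against the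
          constant 1 on a probability space.\<close>
        have "0 \<le> circle.variance (\<lambda>y. cmod (f (x, y)))" by (rule circle.variance_positive)
        also have "\<dots> = (\<integral>y. (cmod (f (x, y)))\<^sup>2 \<partial>\<mu>) - (\<integral>y. cmod (f (x, y)) \<partial>\<mu>)\<^sup>2"
          using elim int by (intro circle.variance_eq) auto
        finally show ?thesis by (simp add: power_mult_distrib mult_left_mono)
      qed
      finally show ?case by simp
    qed
  qed simp
  then show ?thesis using meas by (simp add: sq_int_def)
qed

lemma sq_int_kernel: "cmod z < 1 \<Longrightarrow> sq_int \<mu> (\<lambda>y. 1 / (cis y - z))"
  by (rule circle.sq_int_bounded[where C = "1 / (1 - cmod z)"])
     (use inverse_cis_diff_bound in \<open>auto\<close>)

lemma sq_int_mult_cis: "sq_int \<mu> q \<Longrightarrow> sq_int \<mu> (\<lambda>x. q x * cis (c * x))"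
  using sq_int_bounded_mult[of "\<lambda>x. cis (c * x)" \<mu> 1 q] by (simp add: mult.commute)

text \<open>The numerator e^{iy} of the Cauchy kernel is the exponential that extracts index -1, so
  Fubini turns evaluation into a coefficient of f / (w - z).\<close>

lemma coeff1_cauchy_eval:
  assumes f: "sq_int \<mu>\<^sub>2 f" and z: "cmod z < 1"
  shows "coeff1 (\<lambda>x. cauchy_eval z (\<lambda>y. f (x, y))) m = coeff2 (\<lambda>p. f p * (1 / (cis (snd p) - z))) m (-1)"
proof -
  have "integrable \<mu>\<^sub>2 (\<lambda>p. f p * (1 / (cis (snd p) - z)))"
    by (intro sq_int_mult_integrable f sq_int_snd sq_int_kernel z)
  from torus.integral_fst'[OF integrable_coeff2[OF this, of m "-1"]]
  have "coeff2 (\<lambda>p. f p * (1 / (cis (snd p) - z))) m (-1) =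
    (\<integral>x. \<integral>y. cis (- (of_int m * x)) * (f (x, y) * (cis y / (cis y - z))) \<partial>\<mu> \<partial>\<mu>)"
    by (simp add: coeff2_def mult_ac)
  also have "\<dots> = (\<integral>x. cis (- (of_int m * x)) * cauchy_eval z (\<lambda>y. f (x, y)) \<partial>\<mu>)"
    unfolding cauchy_eval_def by (simp only: integral_mult_right_zero)
  finally show ?thesis
    by (simp only: coeff1_def mult.commute)
qed

text \<open>For m < 0 the coefficients of \<open>f\<close> vanish for every second index, so the
  slice lemma permits the Cauchy kernel as a weight in y.\<close>

lemma H2_1_cauchy_eval:
  assumes f: "f \<in> H2_2" and z: "cmod z < 1"
  shows "(\<lambda>x. cauchy_eval z (\<lambda>y. f (x, y))) \<in> H2_1"
proof -
  note sq = H2_2_sq_int[OF f]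
  have "coeff1 (\<lambda>x. cauchy_eval z (\<lambda>y. f (x, y))) m = 0" if "m < 0" for m
  proof -
    have "(\<integral>p. f p * (1 / (cis (snd p) - z) * cis (1 * snd p)) * cis (- (of_int m * fst p)) \<partial>\<mu>\<^sub>2) = 0"
      using f \<open>m < 0\<close>
      by (intro integral_zero_slice_snd[where q = "\<lambda>y. 1 / (cis y - z) * cis (1 * y)"] sq sq_int_mult_cis sq_int_kernel z)
         (auto simp: H2_2_iff)
    then show ?thesis
      unfolding coeff1_cauchy_eval[OF sq z] coeff2_def by (simp add: mult_ac)
  qed
  then show ?thesis
    by (simp add: H2_1_iff sq_int_cauchy_eval[OF sq z])
qed

lemma integrable_mult_kernel_snd:
  assumes "sq_int \<mu>\<^sub>2 f" "cmod z < 1"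
  shows "integrable \<mu>\<^sub>2 (\<lambda>p. f p * (1 / (cis (snd p) - z)))"
  by (intro sq_int_mult_integrable assms sq_int_snd sq_int_kernel)

text \<open>Since w / (w - z) = 1 + z / (w - z), dividing by w - z turns the Fourier coefficients of
  negative index into a geometric progression.\<close>

lemma coeff2_mult_kernel_step:
  assumes f: "sq_int \<mu>\<^sub>2 f" and z: "cmod z < 1"
  shows "coeff2 (\<lambda>p. f p * (1 / (cis (snd p) - z))) m (n - 1) =
    coeff2 f m n + z * coeff2 (\<lambda>p. f p * (1 / (cis (snd p) - z))) m n"
    (is "coeff2 ?F _ _ = _")
proof -
  note int = integrable_mult_kernel_snd[OF f z]
  have "f p * (1 / (cis (snd p) - z)) * cis (snd p) = f p + z * (f p * (1 / (cis (snd p) - z)))" for p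
    using cis_neq_disc[OF z, of "snd p"] by (simp add: field_simps)
  moreover have "coeff2 ?F m (n - 1) = coeff2 (\<lambda>p. ?F p * cis (snd p)) m n"
  proof -
    have e: "cis (snd p) * cis (- (of_int n * snd p)) = cis (- (of_int (n - 1) * snd p))" for p :: "real \<times> real"
      by (simp add: cis_mult algebra_simps)
    show ?thesis unfolding coeff2_def
      by (intro Bochner_Integration.integral_cong refl) (simp only: e[symmetric], simp only: mult_ac)
  qed
  ultimately have "coeff2 ?F m (n - 1) = coeff2 (\<lambda>p. f p + z * ?F p) m n"
    by (simp only:)
  also have "\<dots> = coeff2 f m n + coeff2 (\<lambda>p. z * ?F p) m n"
    by (intro coeff2_add torus.sq_int_integrable f integrable_mult_right int)
  also have "coeff2 (\<lambda>p. z * ?F p) m n = z * coeff2 ?F m n"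
    by (rule coeff2_cmult)
  finally show ?thesis .
qed

text \<open>The negative indices are written -1 - k. The case k = 0 is the evaluation itself; each
  further step multiplies by z, because \<open>f\<close> contributes nothing at a negative
  index.\<close>

lemma coeff2_mult_kernel_negative:
  assumes f: "f \<in> H2_2" and z: "cmod z < 1"
  shows "coeff2 (\<lambda>p. f p * (1 / (cis (snd p) - z))) m (- 1 - int k) =
    z ^ k * coeff1 (\<lambda>x. cauchy_eval z (\<lambda>y. f (x, y))) m"
proof (induction k)
  case 0
  show ?case by (simp add: coeff1_cauchy_eval[OF H2_2_sq_int[OF f] z])
next
  case (Suc k)
  have "coeff2 f m (- 1 - int k) = 0" using f by (simp add: H2_2_iff)
  then show ?case
    using coeff2_mult_kernel_step[OF H2_2_sq_int[OF f] z, of m "- 1 - int k"] Suc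
    by (simp add: algebra_simps)
qed

lemma H2_2_one: "(\<lambda>p. 1) \<in> H2_2"
  using coeff2_product[of "\<lambda>x. 1" "\<lambda>x. 1"] by (auto simp: H2_2_iff sq_int_def coeff1_one)

text \<open>Splitting w / (w - z) = 1 + z / (w - z) leaves a kernel of mean zero: its conjugate is w
  times a function in H^2.\<close>

lemma cauchy_eval_one:
  assumes z: "cmod z < 1"
  shows "cauchy_eval z (\<lambda>x. 1) = 1"
proof -
  note K = Hinf_cauchy_kernel[OF z]
  have sq: "sq_int \<mu> (\<lambda>x. 1 / (1 - cnj z * cis x))"
    using Hinf_bound[OF K] by (metis circle.sq_int_bounded Hinf_measurable[OF K])
  have "(\<lambda>x. 1 / (1 - cnj z * cis x)) \<in> H2_1"
    using H2_2_mult_fst[OF K H2_2_one] H2_1_fst_iff[OF sq] by simp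
  then have "coeff1 (\<lambda>x. 1 / (1 - cnj z * cis x)) (-1) = 0" by (simp add: H2_1_iff)
  then have "(\<integral>x. cis x * (1 / (1 - cnj z * cis x)) \<partial>\<mu>) = 0"
    by (simp add: coeff1_def mult.commute)
  then have zero: "(\<integral>x. 1 / (cis x - z) \<partial>\<mu>) = 0"
    unfolding inverse_cis_diff[OF z] by (simp only: Bochner_Integration.integral_cnj complex_cnj_zero)
  have "cauchy_eval z (\<lambda>x. 1) = (\<integral>x. 1 + z * (1 / (cis x - z)) \<partial>\<mu>)"
    unfolding cauchy_eval_def
    by (intro Bochner_Integration.integral_cong refl) (use cis_neq_disc[OF z] in \<open>simp add: field_simps\<close>)
  also have "\<dots> = (\<integral>x. 1 \<partial>\<mu>) + (\<integral>x. z * (1 / (cis x - z)) \<partial>\<mu>)"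
    by (intro Bochner_Integration.integral_add integrable_mult_right circle.sq_int_integrable sq_int_kernel z) (simp add: sq_int_def)
  also have "(\<integral>x. z * (1 / (cis x - z)) \<partial>\<mu>) = 0"
    by (simp only: integral_mult_right_zero zero mult_zero_right)
  also have "(\<integral>x. 1 \<partial>\<mu>) + 0 = (1 :: complex)"
    using circle.prob_space by simp
  finally show ?thesis .
qed

lemma H2_1_fst: "u \<in> H2_1 \<Longrightarrow> (\<lambda>p. u (fst p)) \<in> H2_2"
  by (simp add: H2_1_fst_iff H2_1_sq_int)

lemma H2_1_snd: "u \<in> H2_1 \<Longrightarrow> (\<lambda>p. u (snd p)) \<in> H2_2"
  using H2_2_swap[OF H2_1_fst] by simp

lemma coeff1_kernel:
  assumes z: "cmod z < 1"
  shows "coeff1 (\<lambda>y. 1 / (cis y - z)) (- 1 - int k) = z ^ k"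
proof -
  have "coeff2 (\<lambda>p. 1 * (1 / (cis (snd p) - z))) 0 (- 1 - int k) = z ^ k"
    unfolding coeff2_mult_kernel_negative[OF H2_2_one z]
    by (simp add: cauchy_eval_one[OF z] coeff1_one)
  then show ?thesis
    using coeff2_product[of "\<lambda>_. 1" "\<lambda>y. 1 / (cis y - z)" 0 "- 1 - int k"] sq_int_kernel[OF z]
    by (simp add: coeff1_one sq_int_def)
qed

text \<open>The L^2 counterpart of the difference quotient. For n < 0 both f / (w - z) and f(., z) /
  (w - z) have as coefficient the same power of z times the coefficient of f(., z), and they cancel.
  For n >= 0 and m < 0 each of the two vanishes on its own.\<close>

lemma H2_2_divide_snd:
  assumes f: "f \<in> H2_2" and z: "cmod z < 1"
  shows "(\<lambda>p. (f p - cauchy_eval z (\<lambda>y. f (fst p, y))) / (cis (snd p) - z)) \<in> H2_2"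
proof -
  define A where "A x = cauchy_eval z (\<lambda>y. f (x, y))" for x
  have A: "A \<in> H2_1"
    using H2_1_cauchy_eval[OF f z] by (simp add: A_def[abs_def])
  have h: "(\<lambda>p. f p - A (fst p)) \<in> H2_2"
    by (intro H2_2_diff f H2_1_fst A)
  have "sq_int \<mu>\<^sub>2 (\<lambda>p. 1 / (cis (snd p) - z) * (f p - A (fst p)))"
    by (rule sq_int_bounded_mult[OF _ _ H2_2_sq_int[OF h], where C = "1 / (1 - cmod z)"])
       (use inverse_cis_diff_bound[OF z] in auto)
  moreover have "coeff2 (\<lambda>p. (f p - A (fst p)) / (cis (snd p) - z)) m n = 0" if mn: "m < 0 \<or> n < 0" for m n
  proof -
    have sqA: "sq_int \<mu> A" by (rule H2_1_sq_int[OF A])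
    have "coeff2 (\<lambda>p. (f p - A (fst p)) / (cis (snd p) - z)) m n =
      coeff2 (\<lambda>p. f p * (1 / (cis (snd p) - z)) + (- 1) * (A (fst p) * (1 / (cis (snd p) - z)))) m n"
      by (simp add: diff_divide_distrib)
    also have "\<dots> = coeff2 (\<lambda>p. f p * (1 / (cis (snd p) - z))) m n +
        coeff2 (\<lambda>p. (- 1) * (A (fst p) * (1 / (cis (snd p) - z)))) m n"
      by (intro coeff2_add integrable_mult_right integrable_mult_kernel_snd H2_2_sq_int f sq_int_fst sqA z)
    also have "\<dots> = coeff2 (\<lambda>p. f p * (1 / (cis (snd p) - z))) m n - coeff2 (\<lambda>p. A (fst p) * (1 / (cis (snd p) - z))) m n"
      unfolding coeff2_cmult by simp
    also have "coeff2 (\<lambda>p. A (fst p) * (1 / (cis (snd p) - z))) m n = coeff1 A m * coeff1 (\<lambda>y. 1 / (cis y - z)) n"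
      by (rule coeff2_product[OF sqA sq_int_kernel[OF z]])
    also have "coeff2 (\<lambda>p. f p * (1 / (cis (snd p) - z))) m n - \<dots> = 0"
    proof (cases "n < 0")
      case True
      define k where "k = nat (- 1 - n)"
      have k: "n = - 1 - int k" using True by (simp add: k_def)
      show ?thesis
        unfolding k coeff2_mult_kernel_negative[OF f z] coeff1_kernel[OF z] by (simp add: A_def[abs_def])
    next
      case False
      then have "m < 0" using mn by simp
      then have "(\<integral>p. f p * (1 / (cis (snd p) - z) * cis (- of_int n * snd p)) * cis (- (of_int m * fst p)) \<partial>\<mu>\<^sub>2) = 0"
        using f by (intro integral_zero_slice_snd[where q = "\<lambda>y. 1 / (cis y - z) * cis (- of_int n * y)"]
             H2_2_sq_int sq_int_mult_cis sq_int_kernel z)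
           (auto simp: H2_2_iff)
      then have "coeff2 (\<lambda>p. f p * (1 / (cis (snd p) - z))) m n = 0"
        by (simp add: coeff2_def mult_ac)
      then show ?thesis using A \<open>m < 0\<close> by (simp add: H2_1_iff)
    qed
    finally show ?thesis .
  qed
  ultimately show ?thesis
    by (simp add: H2_2_iff A_def)
qed

subsection \<open>Division by a Blaschke product\<close>

text \<open>The coefficients are kept explicit, with \<open>r\<close> chosen before
  \<open>f\<close>: for a function of the second coordinate alone they are visibly constants, which
  yields the one-variable decomposition.\<close>

lemma blaschke_division_snd:
  assumes b: "simple_blaschke b zs n"
  shows "\<exists>r. \<forall>f \<in> H2_2. (\<lambda>p. cnj (b (cis (snd p))) *
    (f p - (\<Sum>i<n. xi b (zs i) (snd p) * (r i * cauchy_eval (zs i) (\<lambda>y. f (fst p, y)))))) \<in> H2_2"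
proof -
  obtain C r where Cr: "\<And>x. cnj (b (cis x)) = C + (\<Sum>i<n. r i / (cis x - zs i))"
    using cnj_blaschke_partial_fractions[OF b] by auto
  show ?thesis
  proof (intro exI[of _ r] ballI)
    fix f assume f: "f \<in> H2_2"
    define E where "E i x = cauchy_eval (zs i) (\<lambda>y. f (x, y))" for i x
    have "cnj (b (cis (snd p))) * (f p - (\<Sum>i<n. xi b (zs i) (snd p) * (r i * E i (fst p)))) =
      C * f p + (\<Sum>i<n. r i * ((f p - E i (fst p)) / (cis (snd p) - zs i)))" for p
    proof -
      have "cnj (b (cis (snd p))) * (f p - (\<Sum>i<n. xi b (zs i) (snd p) * (r i * E i (fst p)))) =
        cnj (b (cis (snd p))) * f p - (\<Sum>i<n. (xi b (zs i) (snd p) * cnj (b (cis (snd p)))) * (r i * E i (fst p)))"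
        by (simp add: right_diff_distrib sum_distrib_left mult_ac)
      also have "\<dots> = C * f p + ((\<Sum>i<n. r i / (cis (snd p) - zs i) * f p) - (\<Sum>i<n. 1 / (cis (snd p) - zs i) * (r i * E i (fst p))))"
        by (simp add: Cr[symmetric] xi_cnj_blaschke[OF b]) (simp add: Cr distrib_right sum_distrib_right)
      also have "\<dots> = C * f p + (\<Sum>i<n. r i * ((f p - E i (fst p)) / (cis (snd p) - zs i)))"
        unfolding sum_subtractf[symmetric]
        by (intro arg_cong2[where f = "(+)"] sum.cong refl) (simp add: diff_divide_distrib right_diff_distrib)
      finally show ?thesis .
    qed
    moreover have "(\<lambda>p. C * f p + (\<Sum>i<n. r i * ((f p - E i (fst p)) / (cis (snd p) - zs i)))) \<in> H2_2"
      unfolding E_def using simple_blaschke_disc[OF b]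
      by (intro H2_2_add H2_2_cmult H2_2_sum H2_2_divide_snd f) auto
    ultimately show "(\<lambda>p. cnj (b (cis (snd p))) *
      (f p - (\<Sum>i<n. xi b (zs i) (snd p) * (r i * cauchy_eval (zs i) (\<lambda>y. f (fst p, y)))))) \<in> H2_2"
      by (simp add: E_def)
  qed
qed

lemma H2_1_cmult: "u \<in> H2_1 \<Longrightarrow> (\<lambda>x. c * u x) \<in> H2_1"
  by (auto simp: H2_1_iff sq_int_cmult coeff1_cmult)

lemma blaschke_cancel: "simple_blaschke b zs n \<Longrightarrow> b (cis x) * (cnj (b (cis x)) * w) = w"
  using blaschke_unimodular[of b zs n x] by (simp flip: mult.assoc)

lemma blaschke_decomposition_snd:
  assumes b: "simple_blaschke b zs n" and f: "f \<in> H2_2"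
  shows "\<exists>a u. (\<forall>i<n. a i \<in> H2_1) \<and> u \<in> H2_2 \<and>
    (\<forall>p. f p = (\<Sum>i<n. xi b (zs i) (snd p) * a i (fst p)) + b (cis (snd p)) * u p)"
proof -
  obtain r where r: "\<And>f. f \<in> H2_2 \<Longrightarrow> (\<lambda>p. cnj (b (cis (snd p))) *
    (f p - (\<Sum>i<n. xi b (zs i) (snd p) * (r i * cauchy_eval (zs i) (\<lambda>y. f (fst p, y)))))) \<in> H2_2"
    using blaschke_division_snd[OF b] by blast
  show ?thesis
  proof (intro exI conjI allI impI)
    show "(\<lambda>p. cnj (b (cis (snd p))) *
      (f p - (\<Sum>i<n. xi b (zs i) (snd p) * (r i * cauchy_eval (zs i) (\<lambda>y. f (fst p, y)))))) \<in> H2_2"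
      by (rule r[OF f])
    show "(\<lambda>x. r i * cauchy_eval (zs i) (\<lambda>y. f (x, y))) \<in> H2_1" if "i < n" for i
      by (intro H2_1_cmult H2_1_cauchy_eval f simple_blaschke_disc[OF b that])
  qed (simp add: blaschke_cancel[OF b])
qed

lemma blaschke_decomposition_fst:
  assumes b: "simple_blaschke b zs n" and f: "f \<in> H2_2"
  shows "\<exists>a u. (\<forall>i<n. a i \<in> H2_1) \<and> u \<in> H2_2 \<and>
    (\<forall>p. f p = (\<Sum>i<n. xi b (zs i) (fst p) * a i (snd p)) + b (cis (fst p)) * u p)"
proof -
  obtain a u where au: "\<forall>i<n. a i \<in> H2_1" "u \<in> H2_2"
    "\<And>p. f (prod.swap p) = (\<Sum>i<n. xi b (zs i) (snd p) * a i (fst p)) + b (cis (snd p)) * u p"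
    using blaschke_decomposition_snd[OF b H2_2_swap[OF f]] by blast
  show ?thesis
    using au(1) H2_2_swap[OF au(2)] au(3)[of "prod.swap _"]
    by (intro exI[of _ a] exI[of _ "\<lambda>p. u (prod.swap p)"]) auto
qed

lemma sq_int_mult_Hinf:
  assumes G: "Hinf g G" and f: "sq_int \<mu> f"
  shows "sq_int \<mu> (\<lambda>x. G x * f x)"
  using Hinf_bound[OF G] by (metis sq_int_bounded_mult[OF Hinf_measurable[OF G] _ f])

lemma sq_int_xi:
  assumes "simple_blaschke b zs n" "i < n"
  shows "sq_int \<mu> (xi b (zs i))"
proof -
  obtain g where g: "Hinf g (xi b (zs i))" using Hinf_xi[OF assms] .
  from sq_int_mult_Hinf[OF this, of "\<lambda>x. 1"] show ?thesis by (simp add: sq_int_def)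
qed

text \<open>Division on the torus applied to v(y): the evaluations do not depend on x, so the
  remainder is again a function of y alone.\<close>

lemma blaschke_decomposition_1:
  assumes b: "simple_blaschke b zs n" and v: "v \<in> H2_1"
  shows "\<exists>c u. u \<in> H2_1 \<and> (\<forall>x. v x = (\<Sum>i<n. xi b (zs i) x * c i) + b (cis x) * u x)"
proof -
  obtain r where r: "\<And>f. f \<in> H2_2 \<Longrightarrow> (\<lambda>p. cnj (b (cis (snd p))) *
    (f p - (\<Sum>i<n. xi b (zs i) (snd p) * (r i * cauchy_eval (zs i) (\<lambda>y. f (fst p, y)))))) \<in> H2_2"
    using blaschke_division_snd[OF b] by blast
  define c where "c i = r i * cauchy_eval (zs i) v" for i
  define u where "u x = cnj (b (cis x)) * (v x - (\<Sum>i<n. xi b (zs i) x * c i))" for x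
  have "sq_int \<mu> (\<lambda>x. v x + (- 1) * (\<Sum>i<n. xi b (zs i) x * c i))"
    using sq_int_cmult[OF sq_int_xi[OF b]]
    by (intro sq_int_add sq_int_cmult sq_int_sum H2_1_sq_int[OF v]) (simp add: mult.commute)
  then have "sq_int \<mu> u"
    unfolding u_def using Hinf_measurable[OF Hinf_blaschke[OF b]]
    by (intro sq_int_bounded_mult[where C = 1]) (auto simp: norm_blaschke_cis[OF b])
  moreover have "(\<lambda>p. u (snd p)) \<in> H2_2"
    using r[OF H2_1_snd[OF v]] by (simp add: u_def c_def)
  ultimately have "u \<in> H2_1"
    using H2_2_swap[of "\<lambda>p. u (snd p)"] by (simp add: H2_1_fst_iff)
  moreover have "v x = (\<Sum>i<n. xi b (zs i) x * c i) + b (cis x) * u x" for x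
    by (simp add: u_def blaschke_cancel[OF b])
  ultimately show ?thesis by blast
qed

text \<open>Since \<open>xi\<close> times conj b is 1 / (w - z), the integrand is the conjugate of
  e^{ix} k'(x, y) conj(v(y)) with \<open>k'\<close> in H^2. The factor e^{ix} moves index -1 to
  index 0, so the whole zeroth row in x vanishes, and \<open>v\<close> may be any square-integrable
  function.\<close>

lemma xi_orthogonal_fst:
  assumes b: "simple_blaschke b zs n" and i: "i < n" and v: "sq_int \<mu> v" and k: "k \<in> H2_2"
  shows "(\<integral>p. xi b (zs i) (fst p) * v (snd p) * cnj (b (cis (fst p)) * k p) \<partial>\<mu>\<^sub>2) = 0"
proof -
  note z = simple_blaschke_disc[OF b i]
  define k' where "k' p = 1 / (1 - cnj (zs i) * cis (fst p)) * k p" for p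
  have k': "k' \<in> H2_2"
    unfolding k'_def[abs_def] by (rule H2_2_mult_fst[OF Hinf_cauchy_kernel[OF z] k])
  have sq: "sq_int \<mu>\<^sub>2 (\<lambda>p. cis (fst p) * k' p)"
    by (rule sq_int_bounded_mult[where C = 1]) (use k' in \<open>auto simp: H2_2_sq_int\<close>)
  have "coeff2 (\<lambda>p. cis (fst p) * k' p) 0 n = 0" for n
    using coeff2_mult_cis_power[of 1 k' 0 n] k' by (simp add: H2_2_iff)
  from integral_zero_slice_snd[OF sq this sq_int_cnj[OF v]]
  have "(\<integral>p. cis (fst p) * k' p * cnj (v (snd p)) \<partial>\<mu>\<^sub>2) = 0" by simp
  then have "(\<integral>p. cnj (cis (fst p) * k' p * cnj (v (snd p))) \<partial>\<mu>\<^sub>2) = 0"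
    by (simp only: Bochner_Integration.integral_cnj complex_cnj_zero)
  moreover have "xi b (zs i) (fst p) * v (snd p) * cnj (b (cis (fst p)) * k p) =
    cnj (cis (fst p) * k' p * cnj (v (snd p)))" for p
  proof -
    have "xi b (zs i) (fst p) * v (snd p) * cnj (b (cis (fst p)) * k p) =
      (xi b (zs i) (fst p) * cnj (b (cis (fst p)))) * (v (snd p) * cnj (k p))"
      by (simp add: mult_ac)
    also have "\<dots> = cnj (cis (fst p) * (1 / (1 - cnj (zs i) * cis (fst p)))) * (v (snd p) * cnj (k p))"
      by (simp only: xi_cnj_blaschke[OF b] inverse_cis_diff[OF z])
    finally show ?thesis by (simp add: k'_def mult_ac)
  qed
  ultimately show ?thesis by (simp only:)
qed

subsection \<open>The model space\<close>

lemma H2_2_mult_xi_fst: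
  "simple_blaschke b zs n \<Longrightarrow> i < n \<Longrightarrow> f \<in> H2_2 \<Longrightarrow> (\<lambda>p. xi b (zs i) (fst p) * f p) \<in> H2_2"
  by (metis Hinf_xi H2_2_mult_fst)

lemma H2_2_mult_xi_snd:
  "simple_blaschke b zs n \<Longrightarrow> i < n \<Longrightarrow> f \<in> H2_2 \<Longrightarrow> (\<lambda>p. xi b (zs i) (snd p) * f p) \<in> H2_2"
  by (metis Hinf_xi H2_2_mult_snd)

lemma norm2_cong_AE:
  assumes "f \<in> borel_measurable \<mu>\<^sub>2" "g \<in> borel_measurable \<mu>\<^sub>2" "AE p in \<mu>\<^sub>2. f p = g p"
  shows "norm2 f = norm2 g"
proof -
  note [measurable] = assms(1,2)
  have "(\<integral>p. (cmod (f p))\<^sup>2 \<partial>\<mu>\<^sub>2) = (\<integral>p. (cmod (g p))\<^sup>2 \<partial>\<mu>\<^sub>2)"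
    by (rule integral_cong_AE) (use assms(3) in auto)
  then show ?thesis by (simp add: norm2_eq)
qed

locale blaschke_pair =
  fixes b1 b2 :: "complex \<Rightarrow> complex" and zs ws :: "nat \<Rightarrow> complex" and n :: nat
  assumes b1: "simple_blaschke b1 zs n" and b2: "simple_blaschke b2 ws n"
begin

definition B :: "real \<times> real \<Rightarrow> complex" where
  "B p = b1 (cis (fst p)) * b2 (cis (snd p))"

lemma cmod_B: "cmod (B p) = 1"
  by (simp add: B_def norm_mult norm_blaschke_cis[OF b1] norm_blaschke_cis[OF b2])

lemma B_cnj_B: "B p * cnj (B p) = 1"
  using cmod_B[of p] by (metis complex_norm_square of_real_1 power_one)

lemma H2_2_mult_B: "k \<in> H2_2 \<Longrightarrow> (\<lambda>p. B p * k p) \<in> H2_2"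
  unfolding B_def mult.assoc
  by (intro H2_2_mult_fst[OF Hinf_blaschke[OF b1]] H2_2_mult_snd[OF Hinf_blaschke[OF b2]])

lemma measurable_B [measurable]: "B \<in> borel_measurable \<mu>\<^sub>2"
  using sq_int_measurable[OF H2_2_sq_int[OF H2_2_mult_B[OF H2_2_one]]] by simp

text \<open>The orthogonal complement of B H^2 in all of L^2; its intersection with
  \<open>H2_2\<close> is the model space.\<close>

definition perp :: "(real \<times> real \<Rightarrow> complex) \<Rightarrow> bool" where
  "perp F \<longleftrightarrow> sq_int \<mu>\<^sub>2 F \<and> (\<forall>k\<in>H2_2. (\<integral>p. F p * cnj (B p * k p) \<partial>\<mu>\<^sub>2) = 0)"

lemma perp_add:
  assumes "perp F" "perp F'"
  shows "perp (\<lambda>p. F p + F' p)"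
  unfolding perp_def
proof (intro conjI ballI)
  show "sq_int \<mu>\<^sub>2 (\<lambda>p. F p + F' p)"
    using assms by (intro sq_int_add) (auto simp: perp_def)
  fix k assume k: "k \<in> H2_2"
  have int: "integrable \<mu>\<^sub>2 (\<lambda>p. F p * cnj (B p * k p))" if "perp F" for F
    using that unfolding perp_def
    by (intro sq_int_mult_integrable sq_int_cnj H2_2_sq_int[OF H2_2_mult_B[OF k]]) auto
  show "(\<integral>p. (F p + F' p) * cnj (B p * k p) \<partial>\<mu>\<^sub>2) = 0"
    unfolding distrib_right
    using assms k by (subst Bochner_Integration.integral_add[OF int int]) (auto simp: perp_def)
qed

lemma perp_sum: "(\<And>i. i \<in> I \<Longrightarrow> perp (F i)) \<Longrightarrow> perp (\<lambda>p. \<Sum>i\<in>I. F i p)"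
proof (induction I rule: infinite_finite_induct)
  case (insert i I)
  then show ?case using perp_add[of "F i" "\<lambda>p. \<Sum>i\<in>I. F i p"] by simp
qed (auto simp: perp_def sq_int_def)

text \<open>The factor \<open>xi\<close> in x alone forces orthogonality; multiplication by b2 in y
  keeps \<open>k\<close> in H^2 and is absorbed there.\<close>

lemma perp_fst:
  assumes i: "i < n" and v: "sq_int \<mu> v"
  shows "perp (\<lambda>p. xi b1 (zs i) (fst p) * v (snd p))"
  unfolding perp_def
proof (intro conjI ballI)
  obtain g where g: "Hinf g (xi b1 (zs i))" using Hinf_xi[OF b1 i] .
  note [measurable] = Hinf_measurable[OF g]
  obtain C where "AE x in \<mu>. cmod (xi b1 (zs i) x) \<le> C" using Hinf_bound[OF g] by metis
  from sq_int_bounded_mult[OF _ AE_circle_fst[OF this] sq_int_snd[OF v]]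
  show "sq_int \<mu>\<^sub>2 (\<lambda>p. xi b1 (zs i) (fst p) * v (snd p))" by simp
  fix k assume k: "k \<in> H2_2"
  from xi_orthogonal_fst[OF b1 i v H2_2_mult_snd[OF Hinf_blaschke[OF b2] k]]
  show "(\<integral>p. xi b1 (zs i) (fst p) * v (snd p) * cnj (B p * k p) \<partial>\<mu>\<^sub>2) = 0"
    by (simp add: B_def mult_ac)
qed

end

text \<open>The preceding result for the pair with the two Blaschke products exchanged, pulled back
  along the coordinate swap.\<close>

lemma (in blaschke_pair) perp_snd:
  assumes j: "j < n" and v: "sq_int \<mu> v"
  shows "perp (\<lambda>p. xi b2 (ws j) (snd p) * v (fst p))"
  unfolding perp_def
proof (intro conjI ballI)
  interpret S: blaschke_pair b2 b1 ws zs n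
    by unfold_locales (fact b2, fact b1)
  have BS: "S.B (prod.swap p) = B p" for p by (simp add: S.B_def B_def)
  note P = S.perp_fst[OF j v, unfolded S.perp_def]
  show sq: "sq_int \<mu>\<^sub>2 (\<lambda>p. xi b2 (ws j) (snd p) * v (fst p))"
    using sq_int_swap[OF P[THEN conjunct1]] by simp
  fix k assume k: "k \<in> H2_2"
  note [measurable] = sq_int_measurable[OF sq] sq_int_measurable[OF H2_2_sq_int[OF k]] S.measurable_B
    sq_int_measurable[OF P[THEN conjunct1]] sq_int_measurable[OF H2_2_sq_int[OF H2_2_swap[OF k]]]
  have "0 = (\<integral>p. xi b2 (ws j) (fst p) * v (snd p) * cnj (S.B p * k (prod.swap p)) \<partial>\<mu>\<^sub>2)"
    using P H2_2_swap[OF k] by simp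
  also have "\<dots> = (\<integral>p. xi b2 (ws j) (snd p) * v (fst p) * cnj (B p * k p) \<partial>\<mu>\<^sub>2)"
    by (subst integral_swap[symmetric], measurable) (simp add: BS)
  finally show "(\<integral>p. xi b2 (ws j) (snd p) * v (fst p) * cnj (B p * k p) \<partial>\<mu>\<^sub>2) = 0" by simp
qed

context blaschke_pair
begin

abbreviation K where "K \<equiv> Kelem b1 b2 zs ws n"

lemma
  assumes h: "\<forall>j<n. h1 j \<in> H2_1" "\<forall>i<n. h2 i \<in> H2_1"
  shows H2_2_Kelem: "K c h1 h2 \<in> H2_2" and perp_Kelem: "perp (K c h1 h2)"
proof -
  \<comment> \<open>Nested products match the closure rules for one-variable factors; the trailing
    \<open>* 1\<close> lets \<open>H2_2_cmult\<close> end at \<open>H2_2_one\<close>.\<close>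
  have eq: "K c h1 h2 = (\<lambda>p.
    (\<Sum>i<n. \<Sum>j<n. xi b1 (zs i) (fst p) * (xi b2 (ws j) (snd p) * (c i j * 1))) +
    (\<Sum>i<n. xi b1 (zs i) (fst p) * (b2 (cis (snd p)) * h2 i (snd p))) +
    (\<Sum>j<n. xi b2 (ws j) (snd p) * (b1 (cis (fst p)) * h1 j (fst p))))"
    by (auto simp: fun_eq_iff Kelem_def Let_def mult_ac)
  show "K c h1 h2 \<in> H2_2"
    unfolding eq using h
    by (intro H2_2_add H2_2_sum H2_2_mult_xi_fst[OF b1] H2_2_mult_xi_snd[OF b2] H2_2_cmult H2_2_one
       H2_2_mult_fst[OF Hinf_blaschke[OF b1]] H2_2_mult_snd[OF Hinf_blaschke[OF b2]] H2_1_fst H2_1_snd) auto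
  have xi: "sq_int \<mu> (\<lambda>y. xi b2 (ws j) y * (c i j * 1))" if "j < n" for i j
    using sq_int_cmult[OF sq_int_xi[OF b2 that], of "c i j"] by (simp add: mult.commute)
  show "perp (K c h1 h2)"
    unfolding eq
  proof (intro perp_add perp_sum)
    fix i assume i: "i \<in> {..<n}"
    show "perp (\<lambda>p. xi b1 (zs i) (fst p) * (xi b2 (ws j) (snd p) * (c i j * 1)))" if "j \<in> {..<n}" for j
      using perp_fst[of i, OF _ xi[of j i]] i that by simp
    show "perp (\<lambda>p. xi b1 (zs i) (fst p) * (b2 (cis (snd p)) * h2 i (snd p)))"
      using i h(2) by (intro perp_fst[where v = "\<lambda>y. b2 (cis y) * h2 i y"] sq_int_mult_Hinf[OF Hinf_blaschke[OF b2]] H2_1_sq_int) auto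
    show "perp (\<lambda>p. xi b2 (ws i) (snd p) * (b1 (cis (fst p)) * h1 i (fst p)))"
      using i h(1) by (intro perp_snd[where v = "\<lambda>y. b1 (cis y) * h1 i y"] sq_int_mult_Hinf[OF Hinf_blaschke[OF b1]] H2_1_sq_int) auto
  qed
qed

text \<open>Divide \<open>f\<close> by b1 in x, then divide by b2 in y both the quotient, which
  gives \<open>h1\<close> and \<open>k\<close>, and each coefficient function \<open>a i\<close>,
  which gives \<open>c\<close> and \<open>h2\<close>.\<close>

lemma H2_2_decomposition:
  assumes f: "f \<in> H2_2"
  shows "\<exists>c h1 h2 k. (\<forall>j<n. h1 j \<in> H2_1) \<and> (\<forall>i<n. h2 i \<in> H2_1) \<and> k \<in> H2_2 \<and>
    (\<forall>p. f p = K c h1 h2 p + B p * k p)"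
proof -
  obtain a u where a: "\<forall>i<n. a i \<in> H2_1" and u: "u \<in> H2_2"
    and f_eq: "\<And>p. f p = (\<Sum>i<n. xi b1 (zs i) (fst p) * a i (snd p)) + b1 (cis (fst p)) * u p"
    using blaschke_decomposition_fst[OF b1 f] by blast
  obtain h1 k where h1: "\<forall>j<n. h1 j \<in> H2_1" and k: "k \<in> H2_2"
    and u_eq: "\<And>p. u p = (\<Sum>j<n. xi b2 (ws j) (snd p) * h1 j (fst p)) + b2 (cis (snd p)) * k p"
    using blaschke_decomposition_snd[OF b2 u] by blast
  have "\<forall>i. \<exists>c h. i < n \<longrightarrow> h \<in> H2_1 \<and> (\<forall>y. a i y = (\<Sum>j<n. xi b2 (ws j) y * c j) + b2 (cis y) * h y)"
    using blaschke_decomposition_1[OF b2] a by blast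
  then obtain c h2 where ch: "\<And>i. i < n \<Longrightarrow> h2 i \<in> H2_1"
    "\<And>i y. i < n \<Longrightarrow> a i y = (\<Sum>j<n. xi b2 (ws j) y * c i j) + b2 (cis y) * h2 i y"
    by metis
  have "f p = K c h1 h2 p + B p * k p" for p
  proof -
    have "(\<Sum>i<n. xi b1 (zs i) (fst p) * a i (snd p)) =
      (\<Sum>i<n. \<Sum>j<n. c i j * xi b1 (zs i) (fst p) * xi b2 (ws j) (snd p)) +
      (\<Sum>i<n. xi b1 (zs i) (fst p) * b2 (cis (snd p)) * h2 i (snd p))"
      unfolding sum.distrib[symmetric]
      by (intro sum.cong refl) (simp add: ch distrib_left sum_distrib_left mult_ac)
    then show ?thesis
      unfolding f_eq u_eq
      by (simp add: Kelem_def Let_def B_def distrib_left sum_distrib_left mult_ac)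
  qed
  then show ?thesis using h1 k ch(1) by blast
qed

end

section \<open>The multiplier as a compression, and equality of the two norms\<close>

locale blaschke_multiplier = blaschke_pair +
  fixes g1 g2 :: "complex \<Rightarrow> complex" and G1 G2 :: "real \<Rightarrow> complex"
  assumes G1: "Hinf g1 G1" and G2: "Hinf g2 G2"
begin

abbreviation \<Gamma> where "\<Gamma> \<equiv> Gamma_up b1 b2 zs ws n g1 G1 g2 G2"

abbreviation \<phi> where
  "\<phi> \<equiv> (\<lambda>p. cnj (b1 (cis (fst p))) * cnj (b2 (cis (snd p))) * G1 (fst p) * G2 (snd p))"

lemma perp_Gamma_up:
  assumes h: "\<forall>j<n. h1 j \<in> H2_1" "\<forall>i<n. h2 i \<in> H2_1"
  shows "perp (\<Gamma> c h1 h2)"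
proof -
  \<comment> \<open>The three-term coefficient is distributed so that one basis function stays free
    of G: the summands with G2(y) or constants keep \<open>xi\<close> in x, while the summand with
    G1(x) keeps the basis function in y.\<close>
  define v where "v i j y = (c i j * g1 (zs i)) * (G2 y * xi b2 (ws j) y) + (- (c i j * g1 (zs i) * g2 (ws j))) * xi b2 (ws j) y" for i j y
  define v' where "v' i j x = (c i j * g2 (ws j)) * (G1 x * xi b1 (zs i) x)" for i j x
  define u where "u i y = g1 (zs i) * (G2 y * (b2 (cis y) * h2 i y))" for i y
  define u' where "u' j x = g2 (ws j) * (G1 x * (b1 (cis x) * h1 j x))" for j x
  have eq: "\<Gamma> c h1 h2 = (\<lambda>p.
    (\<Sum>i<n. \<Sum>j<n. xi b1 (zs i) (fst p) * v i j (snd p) + xi b2 (ws j) (snd p) * v' i j (fst p)) +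
    (\<Sum>i<n. xi b1 (zs i) (fst p) * u i (snd p)) +
    (\<Sum>j<n. xi b2 (ws j) (snd p) * u' j (fst p)))"
    unfolding fun_eq_iff Gamma_up_def Let_def u_def u'_def v_def v'_def
    by (intro allI arg_cong2[where f = "(+)"] sum.cong refl) (simp_all add: algebra_simps)
  have "sq_int \<mu> (v i j)" if "j < n" for i j
    unfolding v_def by (intro sq_int_add sq_int_cmult sq_int_mult_Hinf[OF G2] sq_int_xi[OF b2 that])
  moreover have "sq_int \<mu> (v' i j)" if "i < n" for i j
    unfolding v'_def by (intro sq_int_cmult sq_int_mult_Hinf[OF G1] sq_int_xi[OF b1 that])
  moreover have "sq_int \<mu> (u i)" if "i < n" for i
    unfolding u_def using h that
    by (intro sq_int_cmult sq_int_mult_Hinf[OF G2] sq_int_mult_Hinf[OF Hinf_blaschke[OF b2]] H2_1_sq_int) auto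
  moreover have "sq_int \<mu> (u' j)" if "j < n" for j
    unfolding u'_def using h that
    by (intro sq_int_cmult sq_int_mult_Hinf[OF G1] sq_int_mult_Hinf[OF Hinf_blaschke[OF b1]] H2_1_sq_int) auto
  ultimately show ?thesis
    unfolding eq by (intro perp_add perp_sum perp_fst perp_snd) auto
qed

text \<open>On the model space, Gamma is multiplication by G1 G2 followed by the orthogonal projection.\<close>

lemma Gamma_up_compression:
  assumes h: "\<forall>j<n. h1 j \<in> H2_1" "\<forall>i<n. h2 i \<in> H2_1"
  shows "\<exists>k\<in>H2_2. \<forall>p. G1 (fst p) * G2 (snd p) * K c h1 h2 p = \<Gamma> c h1 h2 p + B p * k p"
proof -
  define D1 where "D1 i x = (G1 x - g1 (zs i)) / (cis x - zs i)" for i x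
  define D2 where "D2 j y = (G2 y - g2 (ws j)) / (cis y - ws j)" for j y
  \<comment> \<open>The identity G1 G2 - (G1 g2 + g1 G2 - g1 g2) = (G1 - g1)(G2 - g2) explains the
    multiplier on the double sum: the error is a product of two difference quotients times B. On the
    single sums the error is (G1 - g1) G2 and G1 (G2 - g2), and the other factor of B is already
    present.\<close>
  define k where "k p = (\<Sum>i<n. \<Sum>j<n. D1 i (fst p) * (D2 j (snd p) * (c i j * 1))) +
    (\<Sum>i<n. D1 i (fst p) * (G2 (snd p) * h2 i (snd p))) +
    (\<Sum>j<n. D2 j (snd p) * (G1 (fst p) * h1 j (fst p)))" for p
  have D1_mult: "(\<lambda>p. D1 i (fst p) * f p) \<in> H2_2" if "i < n" "f \<in> H2_2" for i f
    unfolding D1_def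
    by (rule H2_2_mult_fst[OF Hinf_difference_quotient[OF G1 simple_blaschke_disc[OF b1 that(1)]] that(2)])
  have D2_mult: "(\<lambda>p. D2 i (snd p) * f p) \<in> H2_2" if "i < n" "f \<in> H2_2" for i f
    unfolding D2_def
    by (rule H2_2_mult_snd[OF Hinf_difference_quotient[OF G2 simple_blaschke_disc[OF b2 that(1)]] that(2)])
  have "k \<in> H2_2"
    unfolding k_def[abs_def] using h
    by (intro H2_2_add H2_2_sum D1_mult D2_mult H2_2_cmult H2_2_one H2_2_mult_snd[OF G2] H2_2_mult_fst[OF G1]
      H2_1_fst H2_1_snd) auto
  moreover have "G1 (fst p) * G2 (snd p) * K c h1 h2 p = \<Gamma> c h1 h2 p + B p * k p" for p
  proof -
    obtain x y where p: "p = (x, y)" by fastforce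
    have bD1: "b1 (cis x) * D1 i x = (G1 x - g1 (zs i)) * xi b1 (zs i) x" for i
      by (simp add: D1_def xi_def)
    have bD2: "b2 (cis y) * D2 i y = (G2 y - g2 (ws i)) * xi b2 (ws i) y" for i
      by (simp add: D2_def xi_def)
    have "B p * (\<Sum>i<n. \<Sum>j<n. D1 i x * (D2 j y * (c i j * 1))) =
      (\<Sum>i<n. \<Sum>j<n. c i j * ((G1 x - g1 (zs i)) * xi b1 (zs i) x) * ((G2 y - g2 (ws j)) * xi b2 (ws j) y))"
      unfolding bD1[symmetric] bD2[symmetric] by (simp add: B_def p sum_distrib_left mult_ac)
    moreover have "B p * (\<Sum>i<n. D1 i x * (G2 y * h2 i y)) =
      (\<Sum>i<n. ((G1 x - g1 (zs i)) * xi b1 (zs i) x) * (b2 (cis y) * (G2 y * h2 i y)))"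
      unfolding bD1[symmetric] by (simp add: B_def p sum_distrib_left mult_ac)
    moreover have "B p * (\<Sum>j<n. D2 j y * (G1 x * h1 j x)) =
      (\<Sum>j<n. ((G2 y - g2 (ws j)) * xi b2 (ws j) y) * (b1 (cis x) * (G1 x * h1 j x)))"
      unfolding bD2[symmetric] by (simp add: B_def p sum_distrib_left mult_ac)
    ultimately have "B p * k p =
      (\<Sum>i<n. \<Sum>j<n. c i j * ((G1 x - g1 (zs i)) * xi b1 (zs i) x) * ((G2 y - g2 (ws j)) * xi b2 (ws j) y)) +
      (\<Sum>i<n. ((G1 x - g1 (zs i)) * xi b1 (zs i) x) * (b2 (cis y) * (G2 y * h2 i y))) +
      (\<Sum>j<n. ((G2 y - g2 (ws j)) * xi b2 (ws j) y) * (b1 (cis x) * (G1 x * h1 j x)))"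
      by (simp only: k_def distrib_left p fst_conv snd_conv)
    moreover have "G1 x * G2 y * (\<Sum>i<n. \<Sum>j<n. c i j * xi b1 (zs i) x * xi b2 (ws j) y) =
      (\<Sum>i<n. \<Sum>j<n. c i j * (G1 x * g2 (ws j) + g1 (zs i) * G2 y - g1 (zs i) * g2 (ws j)) * xi b1 (zs i) x * xi b2 (ws j) y) +
      (\<Sum>i<n. \<Sum>j<n. c i j * ((G1 x - g1 (zs i)) * xi b1 (zs i) x) * ((G2 y - g2 (ws j)) * xi b2 (ws j) y))"
      unfolding sum.distrib[symmetric] sum_distrib_left
      by (intro sum.cong refl) (simp add: algebra_simps)
    moreover have "G1 x * G2 y * (\<Sum>i<n. xi b1 (zs i) x * b2 (cis y) * h2 i y) =
      (\<Sum>i<n. g1 (zs i) * G2 y * xi b1 (zs i) x * b2 (cis y) * h2 i y) +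
      (\<Sum>i<n. ((G1 x - g1 (zs i)) * xi b1 (zs i) x) * (b2 (cis y) * (G2 y * h2 i y)))"
      unfolding sum.distrib[symmetric] sum_distrib_left
      by (intro sum.cong refl) (simp add: algebra_simps)
    moreover have "G1 x * G2 y * (\<Sum>j<n. xi b2 (ws j) y * b1 (cis x) * h1 j x) =
      (\<Sum>j<n. G1 x * g2 (ws j) * xi b2 (ws j) y * b1 (cis x) * h1 j x) +
      (\<Sum>j<n. ((G2 y - g2 (ws j)) * xi b2 (ws j) y) * (b1 (cis x) * (G1 x * h1 j x)))"
      unfolding sum.distrib[symmetric] sum_distrib_left
      by (intro sum.cong refl) (simp add: algebra_simps)
    ultimately show ?thesis
      by (simp only: Kelem_def Gamma_up_def Let_def p fst_conv snd_conv distrib_left add_ac)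
  qed
  ultimately show ?thesis by blast
qed

lemma symbol_mult: "\<phi> p * w = cnj (B p) * (G1 (fst p) * G2 (snd p) * w)"
  by (simp add: B_def mult_ac)

lemma cnj_B_cancel: "cnj (B p) * (B p * w) = w"
  using B_cnj_B[of p] by (metis mult.assoc mult.commute mult.left_neutral)

lemma norm2_cnj_B: "norm2 (\<lambda>p. cnj (B p) * F p) = norm2 F"
  by (simp add: norm2_def norm_mult cmod_B)

lemma sq_int_cnj_B: "sq_int \<mu>\<^sub>2 F \<Longrightarrow> sq_int \<mu>\<^sub>2 (\<lambda>p. cnj (B p) * F p)"
  by (rule sq_int_bounded_mult[where C = 1]) (auto simp: cmod_B)

lemma perp_inner2:
  assumes "perp F" "k \<in> H2_2"
  shows "inner2 (\<lambda>p. cnj (B p) * F p) k = 0"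
proof -
  have "sq_int \<mu>\<^sub>2 (\<lambda>p. cnj (B p) * F p)"
    using assms by (intro sq_int_cnj_B) (simp add: perp_def)
  then have "inner2 (\<lambda>p. cnj (B p) * F p) k = (\<integral>p. cnj (B p) * F p * cnj (k p) \<partial>\<mu>\<^sub>2)"
    by (intro inner2_eq sq_int_measurable H2_2_sq_int[OF assms(2)])
  also have "\<dots> = (\<integral>p. F p * cnj (B p * k p) \<partial>\<mu>\<^sub>2)"
    by (simp add: mult_ac)
  finally show ?thesis using assms by (simp add: perp_def)
qed

text \<open>Pythagoras: the cross term integrates to zero. It keeps the model-space component of a
  function from the unit ball inside the unit ball.\<close>

lemma norm2_perp_le:
  assumes e: "perp e" and k: "k \<in> H2_2"
  shows "norm2 e \<le> norm2 (\<lambda>p. e p + B p * k p)"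
proof -
  have sq: "sq_int \<mu>\<^sub>2 e" "sq_int \<mu>\<^sub>2 (\<lambda>p. B p * k p)"
    using e by (auto simp: perp_def intro!: H2_2_sq_int H2_2_mult_B k)
  note sq3 = sq_int_add[OF this]
  have int: "integrable \<mu>\<^sub>2 (\<lambda>p. e p * cnj (B p * k p))"
    by (intro sq_int_mult_integrable sq sq_int_cnj)
  have norm_add: "(cmod (a + b))\<^sup>2 = (cmod a)\<^sup>2 + (cmod b)\<^sup>2 + 2 * Re (a * cnj b)" for a b
    unfolding cmod_power2 by (simp add: power2_eq_square algebra_simps)
  have "(\<integral>p. (cmod (e p + B p * k p))\<^sup>2 \<partial>\<mu>\<^sub>2) =
     (\<integral>p. (cmod (e p))\<^sup>2 + (cmod (B p * k p))\<^sup>2 + 2 * Re (e p * cnj (B p * k p)) \<partial>\<mu>\<^sub>2)"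
    by (simp only: norm_add)
  also have "\<dots> = (\<integral>p. (cmod (e p))\<^sup>2 + (cmod (B p * k p))\<^sup>2 \<partial>\<mu>\<^sub>2) + (\<integral>p. 2 * Re (e p * cnj (B p * k p)) \<partial>\<mu>\<^sub>2)"
    by (intro Bochner_Integration.integral_add Bochner_Integration.integrable_add integrable_mult_right integrable_Re int)
       (use sq in \<open>auto simp: sq_int_def\<close>)
  also have "(\<integral>p. 2 * Re (e p * cnj (B p * k p)) \<partial>\<mu>\<^sub>2) = 2 * Re (\<integral>p. e p * cnj (B p * k p) \<partial>\<mu>\<^sub>2)"
    by (simp only: integral_mult_right_zero integral_Re[OF int])
  also have "(\<integral>p. e p * cnj (B p * k p) \<partial>\<mu>\<^sub>2) = 0"
    using e k by (simp add: perp_def)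
  also have "(\<integral>p. (cmod (e p))\<^sup>2 + (cmod (B p * k p))\<^sup>2 \<partial>\<mu>\<^sub>2) = (\<integral>p. (cmod (e p))\<^sup>2 \<partial>\<mu>\<^sub>2) + (\<integral>p. (cmod (B p * k p))\<^sup>2 \<partial>\<mu>\<^sub>2)"
    by (intro Bochner_Integration.integral_add) (use sq in \<open>auto simp: sq_int_def\<close>)
  finally have "(\<integral>p. (cmod (e p))\<^sup>2 \<partial>\<mu>\<^sub>2) \<le> (\<integral>p. (cmod (e p + B p * k p))\<^sup>2 \<partial>\<mu>\<^sub>2)"
    by (simp add: integral_nonneg_AE)
  then show ?thesis
    using sq sq3 by (simp add: norm2_eq sq_int_measurable)
qed

lemma Gamma_up_norm_eq_hankel_norm: "Gamma_up_norm b1 b2 zs ws n g1 G1 g2 G2 = hankel_norm \<phi>"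
  unfolding Gamma_up_norm_def hankel_norm_def
proof (rule arg_cong[where f = Sup], intro set_eqI iffI)
  fix r
  assume "r \<in> {norm2 (\<Gamma> c h1 h2) | c h1 h2. (\<forall>j<n. h1 j \<in> H2_1) \<and> (\<forall>i<n. h2 i \<in> H2_1) \<and> norm2 (K c h1 h2) \<le> 1}"
  then obtain c h1 h2 where r: "r = norm2 (\<Gamma> c h1 h2)" and h: "\<forall>j<n. h1 j \<in> H2_1" "\<forall>i<n. h2 i \<in> H2_1"
    and le: "norm2 (K c h1 h2) \<le> 1" by auto
  obtain k where k: "k \<in> H2_2" "\<And>p. G1 (fst p) * G2 (snd p) * K c h1 h2 p = \<Gamma> c h1 h2 p + B p * k p"
    using Gamma_up_compression[OF h] by blast
  \<comment> \<open>The test function is the model-space element itself, and the quotient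
    \<open>k\<close> is its projection onto H^2: what remains is conj(B) times the multiplier's
    value, orthogonal to H^2.\<close>
  have eq: "\<phi> p * K c h1 h2 p - k p = cnj (B p) * \<Gamma> c h1 h2 p" for p
    unfolding symbol_mult k(2) by (simp add: distrib_left cnj_B_cancel)
  show "r \<in> {norm2 (\<lambda>p. \<phi> p * f p - h p) | f h. f \<in> H2_2 \<and> norm2 f \<le> 1 \<and> h \<in> H2_2 \<and>
       (\<forall>k\<in>H2_2. inner2 (\<lambda>p. \<phi> p * f p - h p) k = 0)}"
  proof (intro CollectI exI conjI ballI)
    show "r = norm2 (\<lambda>p. \<phi> p * K c h1 h2 p - k p)"
      unfolding eq norm2_cnj_B by (rule r)
    show "inner2 (\<lambda>p. \<phi> p * K c h1 h2 p - k p) k' = 0" if "k' \<in> H2_2" for k'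
      unfolding eq by (rule perp_inner2[OF perp_Gamma_up[OF h] that])
  qed (fact H2_2_Kelem[OF h] le k(1))+
next
  fix r
  assume "r \<in> {norm2 (\<lambda>p. \<phi> p * f p - h p) | f h. f \<in> H2_2 \<and> norm2 f \<le> 1 \<and> h \<in> H2_2 \<and>
       (\<forall>k\<in>H2_2. inner2 (\<lambda>p. \<phi> p * f p - h p) k = 0)}"
  then obtain f h where r: "r = norm2 (\<lambda>p. \<phi> p * f p - h p)" and f: "f \<in> H2_2" "norm2 f \<le> 1"
    and h: "h \<in> H2_2" "\<And>k. k \<in> H2_2 \<Longrightarrow> inner2 (\<lambda>p. \<phi> p * f p - h p) k = 0"
    by auto
  obtain c h1 h2 k where h12: "\<forall>j<n. h1 j \<in> H2_1" "\<forall>i<n. h2 i \<in> H2_1" and k: "k \<in> H2_2"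
    and f_eq: "\<And>p. f p = K c h1 h2 p + B p * k p"
    using H2_2_decomposition[OF f(1)] by blast
  obtain k' where k': "k' \<in> H2_2" "\<And>p. G1 (fst p) * G2 (snd p) * K c h1 h2 p = \<Gamma> c h1 h2 p + B p * k' p"
    using Gamma_up_compression[OF h12] by blast
  \<comment> \<open>The H^2 part of \<open>\<phi>\<close> f read off from the decomposition, minus
    the given projection \<open>h\<close>. Both \<open>R\<close> and \<open>R\<close> +
    \<open>D\<close> are orthogonal to H^2, so \<open>D\<close> is orthogonal to itself and vanishes
    a.e.; this is the a.e. uniqueness of the projection.\<close>
  define D where "D p = k' p + G1 (fst p) * (G2 (snd p) * k p) - h p" for p
  have D: "D \<in> H2_2"
    unfolding D_def[abs_def]
    by (intro H2_2_diff H2_2_add k' h H2_2_mult_fst[OF G1] H2_2_mult_snd[OF G2] k)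
  define R where "R p = cnj (B p) * \<Gamma> c h1 h2 p" for p
  have eq: "\<phi> p * f p - h p = R p + D p" for p
  proof -
    have "\<phi> p * f p = cnj (B p) * (G1 (fst p) * G2 (snd p) * K c h1 h2 p) +
        cnj (B p) * (B p * (G1 (fst p) * (G2 (snd p) * k p)))"
      unfolding symbol_mult f_eq by (simp add: algebra_simps)
    then show ?thesis
      unfolding k'(2) by (simp add: distrib_left cnj_B_cancel R_def D_def)
  qed
  have sq: "sq_int \<mu>\<^sub>2 R" "sq_int \<mu>\<^sub>2 D"
    unfolding R_def using perp_Gamma_up[OF h12] H2_2_sq_int[OF D]
    by (auto intro!: sq_int_cnj_B simp: perp_def)
  note meas [measurable] = sq[THEN sq_int_measurable]
  have "inner2 R D = 0"
    unfolding R_def by (rule perp_inner2[OF perp_Gamma_up[OF h12] D])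
  moreover have "inner2 (\<lambda>p. R p + D p) D = 0"
    using h(2)[OF D] by (simp only: eq)
  moreover have "inner2 (\<lambda>p. R p + D p) D = inner2 R D + inner2 D D"
    unfolding inner2_eq[OF meas] inner2_eq[OF meas(2) meas(2)]
    by (subst inner2_eq) (auto simp: distrib_right intro!: Bochner_Integration.integral_add sq_int_mult_integrable sq sq_int_cnj)
  ultimately have "(\<integral>p. D p * cnj (D p) \<partial>\<mu>\<^sub>2) = 0"
    by (simp add: inner2_eq)
  then have "(\<integral>p. complex_of_real ((cmod (D p))\<^sup>2) \<partial>\<mu>\<^sub>2) = 0"
    by (simp only: complex_norm_square)
  then have "(\<integral>p. (cmod (D p))\<^sup>2 \<partial>\<mu>\<^sub>2) = 0"
    by (simp only: integral_complex_of_real of_real_eq_0_iff)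
  then have "AE p in \<mu>\<^sub>2. (cmod (D p))\<^sup>2 = 0"
    using sq(2) by (subst (asm) integral_nonneg_eq_0_iff_AE) (auto simp: sq_int_def)
  then have "AE p in \<mu>\<^sub>2. R p + D p = R p"
    by eventually_elim simp
  then have "r = norm2 R"
    unfolding r eq by (intro norm2_cong_AE) auto
  then have "r = norm2 (\<Gamma> c h1 h2)"
    by (simp add: R_def[abs_def] norm2_cnj_B)
  moreover have "norm2 (K c h1 h2) \<le> 1"
  proof -
    have "f = (\<lambda>p. K c h1 h2 p + B p * k p)" by (simp add: fun_eq_iff f_eq)
    then show ?thesis
      using norm2_perp_le[OF perp_Kelem[OF h12, of c] k] f(2) by simp
  qed
  ultimately show "r \<in> {norm2 (\<Gamma> c h1 h2) | c h1 h2. (\<forall>j<n. h1 j \<in> H2_1) \<and> (\<forall>i<n. h2 i \<in> H2_1) \<and> norm2 (K c h1 h2) \<le> 1}"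
    using h12 by blast
qed

end

theorem theorem6p2:
  fixes b1 b2 g1 g2 :: "complex \<Rightarrow> complex"
    and zs ws :: "nat \<Rightarrow> complex" and n :: nat
    and G1 G2 :: "real \<Rightarrow> complex"
  assumes "simple_blaschke b1 zs n" and "simple_blaschke b2 ws n"
    and "Hinf g1 G1" and "Hinf g2 G2"
  shows "Gamma_up_norm b1 b2 zs ws n g1 G1 g2 G2 =
         hankel_norm (\<lambda>p. cnj (b1 (cis (fst p))) * cnj (b2 (cis (snd p))) * G1 (fst p) * G2 (snd p))"
proof -
  interpret blaschke_multiplier b1 b2 zs ws n g1 g2 G1 G2
    by unfold_locales fact+
  show ?thesis by (rule Gamma_up_norm_eq_hankel_norm)
qed

end
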